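(* Let $n\ge2$, $\ell>0$, $\alpha\colon[0,\ell]\to(0,\infty)$ of bounded variation with $1/\alpha$ bounded, $a_1,a_2\in\mathbb{R}^n$, $T_1,T_2\in S^{n-1}$. Let $\gamma\in\mathcal{G}$, $T=\gamma'$ and $k=\mathcal{K}_\alpha(\gamma)$. Suppose there exist $\lambda\in S^{n-1}$ and $g\in W^{1,\infty}(0,\ell)\setminus\{0\}$ such that \[ g\bigl((\alpha T')'+k^2T/\alpha\bigr)=k^2\,\mathrm{proj}^\perp_{T,T'}(\lambda),\qquad g'=\alpha\,\lambda\cdot T' \] hold weakly in $(0,\ell)$ (the first in the sense $\int_0^\ell(g\alpha T'\cdot\xi'+g'\alpha T'\cdot\xi-gk^2\alpha^{-1}T\cdot\xi+k^2\mathrm{proj}^\perp_{T,T'}(\lambda)\cdot\xi)\,ds=0$ for all $\xi\in C_0^\infty((0,\ell);\mathbb{R}^n)$), and such that $0\le g\le-\alpha\,\lambda\cdot T$ on $[0,\ell]$. Then $\gamma$ minimises $\mathcal{K}_\alpha$ in $\mathcal{G}$.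
   Context: $S^{n-1}$ is the unit sphere in $\mathbb{R}^n$. $\mathcal{G}$ is the set of all $\gamma\in W^{2,\infty}((0,\ell);\mathbb{R}^n)$ with $|\gamma'|\equiv1$ on $[0,\ell]$ and $\gamma(0)=a_1$, $\gamma(\ell)=a_2$, $\gamma'(0)=T_1$, $\gamma'(\ell)=T_2$. $\mathcal{K}_\alpha(\gamma)=\operatorname{ess\,sup}_{[0,\ell]}\alpha|\gamma''|$. For $V,W\in\mathbb{R}^n$, $\mathrm{proj}^\perp_{V,W}$ is the orthogonal projection onto the orthogonal complement of the span of $V$ and $W$. *)

theory Defs
  imports "HOL-Analysis.Analysis" "HOL-Probability.Essential_Supremum"
begin

definition bounded_variation_on :: "real \<Rightarrow> (real \<Rightarrow> real) \<Rightarrow> bool" where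
  "bounded_variation_on l f \<longleftrightarrow>
     (\<exists>B. \<forall>ts. sorted ts \<and> set ts \<subseteq> {0..l} \<longrightarrow>
        (\<Sum>i<length ts - 1. \<bar>f (ts ! Suc i) - f (ts ! i)\<bar>) \<le> B)"

definition W2inf_rep :: "real \<Rightarrow> (real \<Rightarrow> 'a::euclidean_space) \<Rightarrow> (real \<Rightarrow> 'a) \<Rightarrow> (real \<Rightarrow> 'a) \<Rightarrow> bool" where
  "W2inf_rep l \<gamma> T \<kappa> \<longleftrightarrow>
     (\<forall>s\<in>{0..l}. (\<gamma> has_vector_derivative T s) (at s within {0..l})) \<and>
     (\<forall>s\<in>{0..l}. (\<kappa> has_integral (T s - T 0)) {0..s}) \<and>
     (\<exists>B. \<forall>s\<in>{0..l}. norm (\<kappa> s) \<le> B)"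

definition W1inf_rep :: "real \<Rightarrow> (real \<Rightarrow> real) \<Rightarrow> (real \<Rightarrow> real) \<Rightarrow> bool" where
  "W1inf_rep l g h \<longleftrightarrow>
     (\<forall>s\<in>{0..l}. (h has_integral (g s - g 0)) {0..s}) \<and>
     (\<exists>B. \<forall>s\<in>{0..l}. \<bar>h s\<bar> \<le> B)"

definition in_G :: "real \<Rightarrow> 'a::euclidean_space \<Rightarrow> 'a \<Rightarrow> 'a \<Rightarrow> 'a \<Rightarrow> (real \<Rightarrow> 'a) \<Rightarrow> bool" where
  "in_G l a1 a2 T1 T2 \<gamma> \<longleftrightarrow>
     (\<exists>T \<kappa>. W2inf_rep l \<gamma> T \<kappa> \<and> (\<forall>s\<in>{0..l}. norm (T s) = 1) \<and>
        \<gamma> 0 = a1 \<and> \<gamma> l = a2 \<and> T 0 = T1 \<and> T l = T2)"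

text \<open>K_alpha(gamma) = ess sup over [0,l] of alpha |gamma''| (independent of the
  representative kappa of gamma''; we take the infimum over representatives).\<close>
definition K_alpha :: "(real \<Rightarrow> real) \<Rightarrow> real \<Rightarrow> (real \<Rightarrow> 'a::euclidean_space) \<Rightarrow> ereal" where
  "K_alpha \<alpha> l \<gamma> =
     (INF \<kappa> \<in> {\<kappa>. \<exists>T. W2inf_rep l \<gamma> T \<kappa>}.
        esssup (lebesgue_on {0..l}) (\<lambda>s. ereal (\<alpha> s * norm (\<kappa> s))))"

definition proj_perp :: "'a::euclidean_space \<Rightarrow> 'a \<Rightarrow> 'a \<Rightarrow> 'a" where
  "proj_perp V W x = (THE p. p \<in> orthogonal_comp (span {V, W}) \<and> x - p \<in> span {V, W})"

definition smooth_fun :: "(real \<Rightarrow> real) \<Rightarrow> bool" where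
  "smooth_fun \<phi> \<longleftrightarrow> (\<forall>m x. ((deriv ^^ m) \<phi>) differentiable (at x))"

definition test_fun :: "real \<Rightarrow> (real \<Rightarrow> real) \<Rightarrow> bool" where
  "test_fun l \<phi> \<longleftrightarrow> smooth_fun \<phi> \<and>
     (\<exists>a b. 0 < a \<and> b < l \<and> (\<forall>x. x \<notin> {a..b} \<longrightarrow> \<phi> x = 0))"

definition test_vec :: "real \<Rightarrow> (real \<Rightarrow> 'a::euclidean_space) \<Rightarrow> bool" where
  "test_vec l \<xi> \<longleftrightarrow> (\<forall>b\<in>Basis. test_fun l (\<lambda>s. \<xi> s \<bullet> b))"

end

theory Submission
  imports Defs "HOL-Computational_Algebra.Polynomial"
begin

text \<open>
  The vector \<open>W = g \<alpha> T'\<close> is Lipschitz, and its derivative is \<open>k\<^sup>2 (\<lambda> + \<mu> T)\<close> with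
  \<open>\<mu> = - (\<lambda> \<bullet> T + g / \<alpha>) \<ge> 0\<close>: since \<open>W \<bullet> T = 0\<close>, differentiation gives \<open>\<alpha> |T'| = k\<close> wherever
  \<open>g > 0\<close>, which makes the projection explicit there, while \<open>\<alpha> \<lambda> \<bullet> T' = g' = 0\<close> almost everywhere
  on \<open>{g = 0}\<close>.
  If a competitor with tangent \<open>\<tau>\<close> satisfied \<open>\<alpha> |\<tau>'| \<le> k' < k\<close>, then \<open>W \<bullet> (T' - \<tau>') \<ge> k (k - k') g / \<alpha>\<close>
  and \<open>W' \<bullet> (T - \<tau>) \<ge> k\<^sup>2 \<lambda> \<bullet> (T - \<tau>)\<close>. As \<open>T - \<tau>\<close> vanishes at both ends and has integral zero,
  integrating \<open>(W \<bullet> (T - \<tau>))'\<close> yields \<open>\<integral> g / \<alpha> \<le> 0\<close>, contradicting \<open>0 \<le> g \<noteq> 0\<close>.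
\<close>

section \<open>Lipschitz primitives\<close>

text \<open>\<open>T'\<close> and \<open>(g \<alpha> T')'\<close> are known only through integrals
  and up to null sets, so \<open>T\<close> and \<open>W\<close> are never differentiated pointwise.
  Pairs \<open>lip_prim l F f\<close> record instead that \<open>F\<close> is an integral of the
  bounded \<open>f\<close>, which is what testing yields. \<open>W\<close> is the continuous
  representative of \<open>g \<alpha> T'\<close>, so \<open>W \<bullet> T = 0\<close> holds at every
  point before its derivative is taken. The \<open>T\<close> component fixes the curvature:
  \<open>T'\<close> and the projection are orthogonal to \<open>T\<close>, so
  \<open>W' \<bullet> T = - g k\<^sup>2 / \<alpha>\<close>, while
  \<open>W \<bullet> T' = g \<alpha> |T'|\<^sup>2\<close>. The obstacle is the set
  \<open>g = 0\<close>: no curvature is prescribed there, and the projection need not depend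
  continuously on \<open>T'\<close>. With \<open>\<lambda> \<bullet> T' = 0\<close> it equals
  \<open>\<lambda> - (\<lambda> \<bullet> T) T\<close> whatever \<open>T'\<close> is, so the formula
  for \<open>W'\<close> survives. The hypothesis
  \<open>g \<le> - \<alpha> \<lambda> \<bullet> T\<close> is exactly \<open>\<mu> \<ge> 0\<close>.
  It is useful because \<open>T \<bullet> (T - \<tau>) = 1 - T \<bullet> \<tau> \<ge> 0\<close> for
  unit vectors.\<close>

definition lip_prim :: "real \<Rightarrow> (real \<Rightarrow> 'a::euclidean_space) \<Rightarrow> (real \<Rightarrow> 'a) \<Rightarrow> bool" where
  "lip_prim l F f \<longleftrightarrow>
     (\<forall>s\<in>{0..l}. (f has_integral (F s - F 0)) {0..s}) \<and>
     (\<exists>B. \<forall>s\<in>{0..l}. norm (f s) \<le> B)"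

lemma AE_lebesgue_on_iff:
  assumes "S \<in> sets lebesgue"
  shows "(AE x in lebesgue_on S. P x) \<longleftrightarrow> (\<exists>N. negligible N \<and> (\<forall>x\<in>S - N. P x))"
proof -
  have "(AE x in lebesgue_on S. P x) \<longleftrightarrow> (AE x in lebesgue. x \<in> S \<longrightarrow> P x)"
    using assms by (subst AE_restrict_space_iff) auto
  also have "\<dots> \<longleftrightarrow> (\<exists>N. negligible N \<and> {x. \<not> (x \<in> S \<longrightarrow> P x)} \<subseteq> N)"
    by (rule eventually_ae_filter_negligible)
  finally show ?thesis by blast
qed

lemma has_integral_cong_AE:
  assumes "AE x in lebesgue_on S. f x = g x" "S \<in> sets lebesgue"
  shows "(f has_integral y) S \<longleftrightarrow> (g has_integral y) S"
proof -
  obtain N where "negligible N" "\<forall>x\<in>S - N. f x = g x"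
    using assms by (auto simp: AE_lebesgue_on_iff)
  then show ?thesis by (intro has_integral_spike_eq[of N]) auto
qed

lemma borel_measurable_lebesgue_on_subset:
  assumes "f \<in> borel_measurable (lebesgue_on S)" "T \<subseteq> S" "T \<in> sets lebesgue" "S \<in> sets lebesgue"
  shows "f \<in> borel_measurable (lebesgue_on T)"
  using measurable_restrict_mono[OF assms(1,2)] by simp

lemma bounded_measurable_integrable:
  fixes f :: "real \<Rightarrow> 'b::euclidean_space"
  assumes "f \<in> borel_measurable (lebesgue_on {0..l})" "\<And>s. s \<in> {0..l} \<Longrightarrow> norm (f s) \<le> B"
    and "0 \<le> a" "b \<le> l"
  shows "f integrable_on {a..b}"
proof (rule measurable_bounded_by_integrable_imp_integrable[where g="\<lambda>_. B"])
  show "f \<in> borel_measurable (lebesgue_on {a..b})"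
    by (rule borel_measurable_lebesgue_on_subset[OF assms(1)]) (use assms in auto)
  show "norm (f x) \<le> B" if "x \<in> {a..b}" for x using assms that by simp
qed (rule integrable_const_ivl, simp)

lemma lip_prim_measurable:
  assumes "lip_prim l F f" shows "f \<in> borel_measurable (lebesgue_on {0..l})"
proof (cases "0 \<le> l")
  case True
  then have "f integrable_on {0..l}" using assms unfolding lip_prim_def by force
  then show ?thesis by (rule integrable_imp_measurable)
next
  case False
  then show ?thesis by (intro measurableI) (auto simp: space_restrict_space sets_restrict_space)
qed

lemma lip_prim_interval:
  assumes "lip_prim l F f" "0 \<le> s" "s \<le> t" "t \<le> l"
  shows "(f has_integral (F t - F s)) {s..t}"
proof -
  have t: "(f has_integral (F t - F 0)) {0..t}" and s: "(f has_integral (F s - F 0)) {0..s}"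
    using assms unfolding lip_prim_def by auto
  have "f integrable_on {s..t}"
    by (rule integrable_on_subinterval[OF has_integral_integrable[OF t]]) (use assms in simp)
  then obtain y where y: "(f has_integral y) {s..t}" unfolding integrable_on_def by blast
  have "(f has_integral (F s - F 0 + y)) {0..t}"
    using has_integral_combine[OF assms(2,3) s y] .
  then have "F s - F 0 + y = F t - F 0" using t by (rule has_integral_unique)
  then have "y = (F t - F 0) - (F s - F 0)" by (metis add_diff_cancel_left')
  then show ?thesis using y by simp
qed

lemma lip_prim_lipschitz:
  assumes "lip_prim l F f" "\<And>s. s \<in> {0..l} \<Longrightarrow> norm (f s) \<le> B" "s \<in> {0..l}" "t \<in> {0..l}"
  shows "norm (F t - F s) \<le> B * \<bar>t - s\<bar>"
proof -
  have *: "norm (F t - F s) \<le> B * (t - s)" if "0 \<le> s" "s \<le> t" "t \<le> l" for s t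
  proof -
    have "0 \<le> B" using order_trans[OF norm_ge_zero assms(2)[of s]] that by simp
    from has_integral_bound[OF this, of f "F t - F s" s t] show ?thesis
      using lip_prim_interval[OF assms(1) that] assms(2) that by simp
  qed
  show ?thesis
    using *[of s t] *[of t s] assms(3,4) by (cases "s \<le> t") (auto simp: norm_minus_commute)
qed

lemma lip_prim_continuous_on:
  assumes "lip_prim l F f" shows "continuous_on {0..l} F"
proof -
  obtain B where "\<And>s. s \<in> {0..l} \<Longrightarrow> norm (f s) \<le> B" using assms unfolding lip_prim_def by blast
  then have "norm (F t - F s) \<le> max B 0 * norm (t - s)" if "s \<in> {0..l}" "t \<in> {0..l}" for s t
    using lip_prim_lipschitz[OF assms _ that, of B] mult_right_mono[of B "max B 0" "\<bar>t - s\<bar>"] by fastforce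
  then have "(max B 0)-lipschitz_on {0..l} F"
    by (intro lipschitz_onI) (auto simp: dist_norm)
  then show ?thesis by (rule lipschitz_on_continuous_on)
qed

lemma lip_prim_bounded:
  assumes "lip_prim l F f" obtains B where "B \<ge> 0" "\<And>s. s \<in> {0..l} \<Longrightarrow> norm (F s) \<le> B"
proof -
  have "bounded (F ` {0..l})"
    using lip_prim_continuous_on[OF assms] by (intro compact_imp_bounded compact_continuous_image) auto
  then show ?thesis using that unfolding bounded_pos by (metis imageI less_eq_real_def)
qed

lemma lip_prim_bounded_deriv:
  assumes "lip_prim l F f" obtains B where "B \<ge> 0" "\<And>s. s \<in> {0..l} \<Longrightarrow> norm (f s) \<le> B"
proof -
  obtain B where "\<And>s. s \<in> {0..l} \<Longrightarrow> norm (f s) \<le> B" using assms unfolding lip_prim_def by blast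
  then show ?thesis using that[of "max B 0"] by fastforce
qed

lemma lip_prim_integral:
  fixes f :: "real \<Rightarrow> 'b::euclidean_space"
  assumes "f \<in> borel_measurable (lebesgue_on {0..l})" "\<And>s. s \<in> {0..l} \<Longrightarrow> norm (f s) \<le> B"
  shows "lip_prim l (\<lambda>s. integral {0..s} f) f"
  unfolding lip_prim_def
proof (intro conjI ballI exI[of _ B])
  show "(f has_integral (integral {0..s} f - integral {0..0} f)) {0..s}" if "s \<in> {0..l}" for s
    using bounded_measurable_integrable[OF assms, of 0 s] that by (simp add: integrable_integral)
qed (use assms in auto)

text \<open>The difference quotient at \<open>x\<close> is at most
  \<open>C * \<bar>y - x\<bar>\<close>, so the derivative exists and is zero at every point, the
  ends of the interval included.\<close>

lemma constant_if_quadratic_increments: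
  fixes H :: "real \<Rightarrow> 'b::euclidean_space"
  assumes H: "\<And>s t. 0 \<le> s \<Longrightarrow> s \<le> t \<Longrightarrow> t \<le> l \<Longrightarrow> norm (H t - H s) \<le> C * (t - s)\<^sup>2"
    and s: "s \<in> {0..l}"
  shows "H s = H 0"
proof -
  have H': "norm (H t - H s) \<le> C * (t - s)\<^sup>2" if "s \<in> {0..l}" "t \<in> {0..l}" for s t
    using H[of s t] H[of t s] that
    by (cases "s \<le> t") (auto simp: norm_minus_commute power2_commute)
  have "(H has_derivative (\<lambda>_. 0)) (at x within {0..l})" if x: "x \<in> {0..l}" for x
  proof -
    have "((\<lambda>y. norm (H y - H x) / norm (y - x)) \<longlongrightarrow> 0) (at x within {0..l})"
    proof (rule tendsto_sandwich[of "\<lambda>_. 0" _ _ "\<lambda>y. C * \<bar>y - x\<bar>"])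
      have "norm (H y - H x) / norm (y - x) \<le> C * \<bar>y - x\<bar>" if "y \<in> {0..l}" "y \<noteq> x" for y
      proof -
        have "norm (H y - H x) \<le> C * \<bar>y - x\<bar> * \<bar>y - x\<bar>"
          using H'[OF x that(1)] by (simp add: power2_eq_square mult.assoc)
        then show ?thesis using that by (simp add: divide_le_eq)
      qed
      then show "\<forall>\<^sub>F y in at x within {0..l}. norm (H y - H x) / norm (y - x) \<le> C * \<bar>y - x\<bar>"
        by (auto simp: eventually_at_filter)
      show "((\<lambda>y. C * \<bar>y - x\<bar>) \<longlongrightarrow> 0) (at x within {0..l})"
        by (rule tendsto_eq_intros refl | simp)+
    qed auto
    then show ?thesis
      by (simp add: has_derivative_iff_norm)
  qed
  then show ?thesis
    using has_derivative_zero_unique[of "{0..l}" H 0 s] s by auto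
qed

text \<open>
  Product and chain rules follow from the next lemma without almost-everywhere differentiation:
  a function whose increments are quadratically small is constant.
\<close>

lemma lip_prim_quadratic:
  fixes F f :: "real \<Rightarrow> 'a::euclidean_space"
  assumes meas: "f \<in> borel_measurable (lebesgue_on {0..l})"
    and bd: "\<And>s. s \<in> {0..l} \<Longrightarrow> norm (f s) \<le> B"
    and I: "\<And>s t. 0 \<le> s \<Longrightarrow> s \<le> t \<Longrightarrow> t \<le> l \<Longrightarrow>
       \<exists>e. (e has_integral (F t - F s)) {s..t} \<and> (\<forall>r\<in>{s..t}. norm (e r - f r) \<le> C * (t - s))"
  shows "lip_prim l F f"
proof -
  \<comment> \<open>\<open>K\<close> is the primitive that \<open>f\<close> certainly has. Over
    \<open>{s..t}\<close> the integrands \<open>e\<close> and \<open>f\<close> differ by at most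
    \<open>C * (t - s)\<close>, so the increments of \<open>F - K\<close> are quadratically
    small.\<close>
  define K where "K = (\<lambda>s. integral {0..s} f)"
  have K: "lip_prim l K f" unfolding K_def by (rule lip_prim_integral[OF meas bd])
  have "F s - K s = F 0 - K 0" if "s \<in> {0..l}" for s
  proof (rule constant_if_quadratic_increments[OF _ that])
    fix s t :: real assume st: "0 \<le> s" "s \<le> t" "t \<le> l"
    obtain e where e: "(e has_integral (F t - F s)) {s..t}" "\<And>r. r \<in> {s..t} \<Longrightarrow> norm (e r - f r) \<le> C * (t - s)"
      using I[OF st] by auto
    have i: "((\<lambda>r. e r - f r) has_integral (F t - F s) - (K t - K s)) (cbox s t)"
      using has_integral_diff[OF e(1) lip_prim_interval[OF K st]] by simp
    have "0 \<le> C * (t - s)" using order_trans[OF norm_ge_zero e(2)[of s]] st by simp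
    from has_integral_bound[OF this i] e(2) st
    have "norm ((F t - F s) - (K t - K s)) \<le> C * (t - s) * (t - s)" by simp
    moreover have "(F t - F s) - (K t - K s) = (F t - K t) - (F s - K s)" by simp
    ultimately show "norm ((F t - K t) - (F s - K s)) \<le> C * (t - s)\<^sup>2"
      by (simp add: power2_eq_square)
  qed
  then have const: "F s - K s = F 0 - K 0" if "s \<in> {0..l}" for s using that by blast
  have eq: "F s - F 0 = K s - K 0" if "s \<in> {0..l}" for s
  proof -
    have "F s - F 0 = (F s - K s) - (F 0 - K 0) + (K s - K 0)" by simp
    then show ?thesis unfolding const[OF that] by simp
  qed
  show ?thesis
    unfolding lip_prim_def
  proof (intro conjI ballI)
    show "(f has_integral (F s - F 0)) {0..s}" if "s \<in> {0..l}" for s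
    proof -
      have "(f has_integral (K s - K 0)) {0..s}" using K that unfolding lip_prim_def by blast
      then show ?thesis by (subst eq[OF that])
    qed
  qed (use K in \<open>auto simp: lip_prim_def\<close>)
qed

lemma lip_prim_inner:
  fixes F G :: "real \<Rightarrow> 'a::euclidean_space"
  assumes F: "lip_prim l F f" and G: "lip_prim l G g"
  shows "lip_prim l (\<lambda>s. F s \<bullet> G s) (\<lambda>s. f s \<bullet> G s + F s \<bullet> g s)"
proof -
  obtain A where A: "A \<ge> 0" "\<And>s. s \<in> {0..l} \<Longrightarrow> norm (F s) \<le> A" using lip_prim_bounded[OF F] by blast
  obtain A' where A': "A' \<ge> 0" "\<And>s. s \<in> {0..l} \<Longrightarrow> norm (G s) \<le> A'" using lip_prim_bounded[OF G] by blast
  obtain B where B: "B \<ge> 0" "\<And>s. s \<in> {0..l} \<Longrightarrow> norm (f s) \<le> B" using lip_prim_bounded_deriv[OF F] by blast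
  obtain B' where B': "B' \<ge> 0" "\<And>s. s \<in> {0..l} \<Longrightarrow> norm (g s) \<le> B'" using lip_prim_bounded_deriv[OF G] by blast
  have cont: "F \<in> borel_measurable (lebesgue_on {0..l})" "G \<in> borel_measurable (lebesgue_on {0..l})"
    using F G by (auto intro: continuous_imp_measurable_on_sets_lebesgue lip_prim_continuous_on)
  show ?thesis
  proof (rule lip_prim_quadratic[where B = "B * A' + A * B'" and C = "B * B' + B * B'"])
    show "norm (f s \<bullet> G s + F s \<bullet> g s) \<le> B * A' + A * B'" if "s \<in> {0..l}" for s
    proof -
      have "norm (f s \<bullet> G s + F s \<bullet> g s) \<le> norm (f s) * norm (G s) + norm (F s) * norm (g s)"
        using norm_triangle_ineq[of "f s \<bullet> G s" "F s \<bullet> g s"] Cauchy_Schwarz_ineq2[of "f s" "G s"]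
          Cauchy_Schwarz_ineq2[of "F s" "g s"] by simp
      also have "\<dots> \<le> B * A' + A * B'"
        using A A' B B' that by (intro add_mono mult_mono) auto
      finally show ?thesis .
    qed
    fix s t :: real assume st: "0 \<le> s" "s \<le> t" "t \<le> l"
    have "((\<lambda>r. f r \<bullet> G s + F t \<bullet> g r) has_integral (F t - F s) \<bullet> G s + F t \<bullet> (G t - G s)) {s..t}"
      by (intro has_integral_add has_integral_linear[OF _ bounded_linear_inner_left, unfolded o_def]
          has_integral_linear[OF _ bounded_linear_inner_right, unfolded o_def]
          lip_prim_interval[OF F] lip_prim_interval[OF G] st)
    moreover have "(F t - F s) \<bullet> G s + F t \<bullet> (G t - G s) = F t \<bullet> G t - F s \<bullet> G s"
      by (simp add: inner_diff_left inner_diff_right)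
    moreover have "norm ((f r \<bullet> G s + F t \<bullet> g r) - (f r \<bullet> G r + F r \<bullet> g r)) \<le> (B * B' + B * B') * (t - s)"
      if r: "r \<in> {s..t}" for r
    proof -
      have "norm ((f r \<bullet> G s + F t \<bullet> g r) - (f r \<bullet> G r + F r \<bullet> g r))
          = norm (f r \<bullet> (G s - G r) + (F t - F r) \<bullet> g r)" by (simp add: algebra_simps)
      also have "\<dots> \<le> norm (f r) * norm (G s - G r) + norm (F t - F r) * norm (g r)"
        using norm_triangle_ineq[of "f r \<bullet> (G s - G r)" "(F t - F r) \<bullet> g r"]
          Cauchy_Schwarz_ineq2[of "f r" "G s - G r"] Cauchy_Schwarz_ineq2[of "F t - F r" "g r"] by simp
      also have "\<dots> \<le> B * (B' * (t - s)) + (B * (t - s)) * B'"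
      proof (intro add_mono mult_mono)
        have "norm (G s - G r) \<le> B' * \<bar>s - r\<bar>" by (rule lip_prim_lipschitz[OF G B'(2)]) (use st r in auto)
        also have "\<dots> \<le> B' * (t - s)" using r B' by (intro mult_left_mono) auto
        finally show "norm (G s - G r) \<le> B' * (t - s)" .
        have "norm (F t - F r) \<le> B * \<bar>t - r\<bar>" by (rule lip_prim_lipschitz[OF F B(2)]) (use st r in auto)
        also have "\<dots> \<le> B * (t - s)" using r B by (intro mult_left_mono) auto
        finally show "norm (F t - F r) \<le> B * (t - s)" .
      qed (use B B' st r in auto)
      finally show ?thesis by (simp add: algebra_simps)
    qed
    ultimately show "\<exists>e. (e has_integral (F t \<bullet> G t - F s \<bullet> G s)) {s..t} \<and>
        (\<forall>r\<in>{s..t}. norm (e r - (f r \<bullet> G r + F r \<bullet> g r)) \<le> (B * B' + B * B') * (t - s))"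
      by (intro exI[of _ "\<lambda>r. f r \<bullet> G s + F t \<bullet> g r"]) auto
  qed (intro borel_measurable_add borel_measurable_inner cont lip_prim_measurable[OF F] lip_prim_measurable[OF G])
qed

lemma lip_prim_diff:
  assumes "lip_prim l F f" "lip_prim l G g"
  shows "lip_prim l (\<lambda>s. F s - G s) (\<lambda>s. f s - g s)"
proof -
  obtain B where B: "B \<ge> 0" "\<And>s. s \<in> {0..l} \<Longrightarrow> norm (f s) \<le> B" using lip_prim_bounded_deriv[OF assms(1)] by blast
  obtain B' where B': "B' \<ge> 0" "\<And>s. s \<in> {0..l} \<Longrightarrow> norm (g s) \<le> B'" using lip_prim_bounded_deriv[OF assms(2)] by blast
  have "norm (f s - g s) \<le> B + B'" if "s \<in> {0..l}" for s
    using B(2)[OF that] B'(2)[OF that] norm_triangle_ineq4[of "f s" "g s"] by linarith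
  moreover have "((\<lambda>s. f s - g s) has_integral (F s - G s - (F 0 - G 0))) {0..s}" if "s \<in> {0..l}" for s
  proof -
    have "(f has_integral (F s - F 0)) {0..s}" "(g has_integral (G s - G 0)) {0..s}"
      using assms that unfolding lip_prim_def by blast+
    from has_integral_diff[OF this] show ?thesis by (simp add: algebra_simps)
  qed
  ultimately show ?thesis unfolding lip_prim_def by blast
qed

lemma lip_prim_inner_const:
  assumes "lip_prim l F f"
  shows "lip_prim l (\<lambda>s. F s \<bullet> b) (\<lambda>s. f s \<bullet> b)"
proof -
  have "lip_prim l (\<lambda>_. b) (\<lambda>_. 0)" unfolding lip_prim_def by auto
  from lip_prim_inner[OF assms this] show ?thesis by simp
qed

text \<open>Serves as a bounded smooth truncation in the treatment of the zero set of
  \<open>F\<close>. The chain rule works because the derivative \<open>1 / (1 + x\<^sup>2)\<close>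
  is itself Lipschitz.\<close>

lemma lip_prim_arctan:
  fixes F f :: "real \<Rightarrow> real"
  assumes F: "lip_prim l F f"
  shows "lip_prim l (\<lambda>s. arctan (F s)) (\<lambda>s. f s / (1 + (F s)\<^sup>2))"
proof -
  obtain B where B: "B \<ge> 0" "\<And>s. s \<in> {0..l} \<Longrightarrow> norm (f s) \<le> B" using lip_prim_bounded_deriv[OF F] by blast
  have [measurable]: "F \<in> borel_measurable (lebesgue_on {0..l})"
    using F by (auto intro: continuous_imp_measurable_on_sets_lebesgue lip_prim_continuous_on)
  note [measurable] = lip_prim_measurable[OF F]
  have lip: "\<bar>1 / (1 + x\<^sup>2) - 1 / (1 + y\<^sup>2)\<bar> \<le> \<bar>x - y\<bar>" for x y :: real
  proof -
    have p: "1 + x\<^sup>2 > 0" "1 + y\<^sup>2 > 0" by (auto intro: add_pos_nonneg)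
    have "1 / (1 + x\<^sup>2) - 1 / (1 + y\<^sup>2) = (y - x) * ((y + x) / ((1 + x\<^sup>2) * (1 + y\<^sup>2)))"
      using p by (simp add: field_simps power2_eq_square)
    moreover have "\<bar>(y + x) / ((1 + x\<^sup>2) * (1 + y\<^sup>2))\<bar> \<le> 1"
    proof -
      have "2 * \<bar>x\<bar> \<le> 1 + x\<^sup>2" "2 * \<bar>y\<bar> \<le> 1 + y\<^sup>2"
        using zero_le_power2[of "\<bar>x\<bar> - 1"] zero_le_power2[of "\<bar>y\<bar> - 1"] by (auto simp: power2_diff)
      then have "\<bar>y + x\<bar> \<le> 1 + x\<^sup>2 + y\<^sup>2" by (smt (verit) zero_le_power2)
      also have "\<dots> \<le> (1 + x\<^sup>2) * (1 + y\<^sup>2)" by (simp add: algebra_simps)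
      finally show ?thesis using p by (simp add: abs_mult)
    qed
    ultimately show ?thesis
      by (metis abs_ge_zero abs_minus_commute abs_mult mult.right_neutral mult_left_mono)
  qed
  show ?thesis
  proof (rule lip_prim_quadratic[where B = B and C = "B * B"])
    show "norm (f s / (1 + (F s)\<^sup>2)) \<le> B" if "s \<in> {0..l}" for s
    proof -
      have "\<bar>f s\<bar> / (1 + (F s)\<^sup>2) \<le> \<bar>f s\<bar> / 1"
        by (intro divide_left_mono) (auto intro: add_pos_nonneg)
      then show ?thesis using B(2)[OF that] by simp
    qed
    fix s t :: real assume st: "0 \<le> s" "s \<le> t" "t \<le> l"
    have mvt: "\<exists>z\<in>{a..b}. arctan b - arctan a = (b - a) * (1 / (1 + z\<^sup>2))" if "a \<le> b" for a b :: real
    proof (cases "a = b")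
      case False
      then have "a < b" using that by simp
      then have "\<exists>z>a. z < b \<and> arctan b - arctan a = (b - a) * inverse (1 + z\<^sup>2)"
        by (rule MVT2) (rule DERIV_arctan)
      then obtain z where "a < z" "z < b" "arctan b - arctan a = (b - a) * inverse (1 + z\<^sup>2)" by blast
      then show ?thesis by (intro bexI[of _ z]) (simp_all add: inverse_eq_divide)
    qed simp
    have "\<exists>z\<in>{min (F s) (F t)..max (F s) (F t)}. arctan (F t) - arctan (F s) = (F t - F s) * (1 / (1 + z\<^sup>2))"
    proof (cases "F s \<le> F t")
      case True
      then show ?thesis using mvt[OF True] by (simp add: min_def max_def)
    next
      case False
      then obtain z where z: "z \<in> {F t..F s}" "arctan (F s) - arctan (F t) = (F s - F t) * (1 / (1 + z\<^sup>2))"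
        using mvt[of "F t" "F s"] by auto
      from z(2) have "- (arctan (F s) - arctan (F t)) = - ((F s - F t) * (1 / (1 + z\<^sup>2)))" by simp
      then have "arctan (F t) - arctan (F s) = (F t - F s) * (1 / (1 + z\<^sup>2))"
        by (simp only: minus_mult_left minus_diff_eq)
      then show ?thesis using z(1) False by (intro bexI[of _ z]) auto
    qed
    \<comment> \<open>One mean value point serves the whole of \<open>{s..t}\<close>: lying between
      \<open>F s\<close> and \<open>F t\<close>, it is within \<open>B * (t - s)\<close> of every
      \<open>F r\<close>.\<close>
    then obtain z where z: "z \<in> {min (F s) (F t)..max (F s) (F t)}"
      "arctan (F t) - arctan (F s) = (F t - F s) * (1 / (1 + z\<^sup>2))" by blast
    have "((\<lambda>r. f r * (1 / (1 + z\<^sup>2))) has_integral (arctan (F t) - arctan (F s))) {s..t}"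
      unfolding z(2) by (intro has_integral_mult_left lip_prim_interval[OF F] st)
    moreover have "norm (f r * (1 / (1 + z\<^sup>2)) - f r / (1 + (F r)\<^sup>2)) \<le> B * B * (t - s)"
      if r: "r \<in> {s..t}" for r
    proof -
      have "\<bar>F s - F r\<bar> \<le> B * \<bar>s - r\<bar>" "\<bar>F t - F r\<bar> \<le> B * \<bar>t - r\<bar>"
        using lip_prim_lipschitz[OF F B(2), of r s] lip_prim_lipschitz[OF F B(2), of r t] r st by auto
      moreover have "B * \<bar>s - r\<bar> \<le> B * (t - s)" "B * \<bar>t - r\<bar> \<le> B * (t - s)"
        using r B by (auto intro!: mult_left_mono)
      ultimately have "\<bar>z - F r\<bar> \<le> B * (t - s)"
        using z(1) by (auto simp: min_def max_def split: if_splits)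
      then have *: "\<bar>1 / (1 + z\<^sup>2) - 1 / (1 + (F r)\<^sup>2)\<bar> \<le> B * (t - s)"
        using lip[of z "F r"] by linarith
      have "norm (f r * (1 / (1 + z\<^sup>2)) - f r / (1 + (F r)\<^sup>2)) = \<bar>f r\<bar> * \<bar>1 / (1 + z\<^sup>2) - 1 / (1 + (F r)\<^sup>2)\<bar>"
        by (simp add: abs_mult[symmetric] right_diff_distrib)
      also have "\<dots> \<le> B * (B * (t - s))"
        using B r st * by (intro mult_mono) auto
      finally show ?thesis by (simp add: mult.assoc)
    qed
    ultimately show "\<exists>e. (e has_integral (arctan (F t) - arctan (F s))) {s..t} \<and>
        (\<forall>r\<in>{s..t}. norm (e r - f r / (1 + (F r)\<^sup>2)) \<le> B * B * (t - s))" by blast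
  qed measurable
qed

text \<open>The Borel sets over which \<open>f\<close> integrates to zero contain the intervals and
  are closed under complements and countable disjoint unions, hence are all Borel sets. A Lebesgue
  set differs from a Borel set by a null set, and uniqueness of densities concludes.\<close>

lemma AE_zero_if_integral_intervals_zero:
  fixes f :: "real \<Rightarrow> real"
  assumes f: "integrable lebesgue f"
    and 0: "\<And>a b. a \<le> b \<Longrightarrow> (LINT x:{a..b}|lebesgue. f x) = 0"
  shows "AE x in lebesgue. f x = 0"
proof -
  have si: "set_integrable lebesgue A f" if "A \<in> sets lebesgue" for A
    using integrable_mult_indicator[OF that f] by (simp add: set_integrable_def)
  have I: "(LINT x:{a..b}|lebesgue. f x) = 0" for a b
    using 0[of a b] by (cases "a \<le> b") (auto simp: set_lebesgue_integral_def)
  \<comment> \<open>Exhaustion by the intervals \<open>{-n..n}\<close>. The total integral is what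
    the complement case of the induction needs.\<close>
  have tot: "(LINT x|lebesgue. f x) = 0"
  proof -
    have "(\<lambda>n::nat. LINT x|lebesgue. indicator {-real n..real n} x *\<^sub>R f x) \<longlonglongrightarrow> (LINT x|lebesgue. f x)"
    proof (rule integral_dominated_convergence[where w = "\<lambda>x. \<bar>f x\<bar>"])
      show "AE x in lebesgue. (\<lambda>n::nat. indicator {-real n..real n} x *\<^sub>R f x) \<longlonglongrightarrow> f x"
      proof (rule AE_I2, rule tendsto_eventually)
        fix x :: real
        obtain N where "\<bar>x\<bar> \<le> real N" using real_arch_simple by blast
        then show "\<forall>\<^sub>F n in sequentially. indicator {-real n..real n} x *\<^sub>R f x = f x"
          by (intro eventually_sequentiallyI[of N]) (auto simp: indicator_def)
      qed
    qed (use f si[of "{-real _..real _}"] in \<open>auto simp: indicator_def set_integrable_def\<close>)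
    then show ?thesis using I LIMSEQ_unique[of "\<lambda>_. 0" 0] unfolding set_lebesgue_integral_def by auto
  qed
  have borel: "(LINT x:A|lebesgue. f x) = 0" if "A \<in> sets borel" for A
    using that
  proof (induction rule: borel_set_induct)
    case (compl A)
    then have A: "A \<in> sets lebesgue" by simp
    have "(LINT x:- A|lebesgue. f x) = (LINT x|lebesgue. f x) - (LINT x:A|lebesgue. f x)"
    proof -
      have "(LINT x|lebesgue. indicator (- A) x *\<^sub>R f x) = (LINT x|lebesgue. f x - indicator A x *\<^sub>R f x)"
        by (intro Bochner_Integration.integral_cong) (auto simp: indicator_def)
      also have "\<dots> = (LINT x|lebesgue. f x) - (LINT x|lebesgue. indicator A x *\<^sub>R f x)"
        using f si[OF A, unfolded set_integrable_def] by (rule Bochner_Integration.integral_diff)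
      finally show ?thesis unfolding set_lebesgue_integral_def .
    qed
    then show ?case using compl tot by simp
  next
    case (union A)
    have A: "A i \<in> sets lebesgue" for i using union(2)[of i] by simp
    have "(LINT x:(\<Union>i. A i)|lebesgue. f x) = (\<Sum>i. (LINT x:(A i)|lebesgue. f x))"
    proof (rule lebesgue_integral_countable_add)
      show "A i \<inter> A j = {}" if "i \<noteq> j" for i j
        using union(1) that by (auto simp: disjoint_family_on_def)
    qed (use A si in auto)
    then show ?case using union by simp
  next
    case empty
    show ?case by (simp add: set_lebesgue_integral_def)
  next
    case (interval a b)
    show ?case by (rule I)
  qed
  show ?thesis
  proof (rule density_unique_real[OF f, of "\<lambda>_. 0"])
    fix A :: "real set" assume A: "A \<in> sets lebesgue"
    have "(LINT x:A|lebesgue. f x) = (LINT x:main_part lborel A|lebesgue. f x)"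
      unfolding set_lebesgue_integral_def
    proof (rule integral_cong_AE)
      show "AE x in lebesgue. indicator A x *\<^sub>R f x = indicator (main_part lborel A) x *\<^sub>R f x"
        using AE_completion[OF AE_notin_null_part[OF A]]
      proof eventually_elim
        case (elim x)
        then have "x \<in> A \<longleftrightarrow> x \<in> main_part lborel A" using main_part_null_part_Un[OF A] by blast
        then show ?case by (simp add: indicator_def)
      qed
      have "main_part lborel A \<in> sets lebesgue"
        using main_part_sets[OF A] by simp
      then show "(\<lambda>x. indicator (main_part lborel A) x *\<^sub>R f x) \<in> borel_measurable lebesgue"
        using f by (intro borel_measurable_scaleR borel_measurable_indicator) auto
    qed (use f A in \<open>auto intro!: borel_measurable_scaleR borel_measurable_indicator\<close>)
    also have "\<dots> = 0" using A by (intro borel) (metis main_part_sets sets_lborel)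
    finally show "(LINT x:A|lebesgue. f x) = (LINT x:A|lebesgue. 0)" by (simp add: set_lebesgue_integral_def)
  qed simp
qed

text \<open>Passes from the gauge integral to the Lebesgue integral. After extension by zero,
  \<open>{a..b}\<close> contributes only through its intersection \<open>{max 0 a..min l b}\<close>
  with the domain, where the integral is an increment of \<open>F\<close>.\<close>

lemma AE_zero_if_indefinite_integral_zero:
  fixes f :: "real \<Rightarrow> real"
  assumes F: "lip_prim l F f" and 0: "\<And>s. s \<in> {0..l} \<Longrightarrow> F s = F 0"
  shows "AE s in lebesgue_on {0..l}. f s = 0"
proof -
  obtain B where B: "B \<ge> 0" "\<And>s. s \<in> {0..l} \<Longrightarrow> norm (f s) \<le> B" using lip_prim_bounded_deriv[OF F] by blast
  have abs: "f absolutely_integrable_on {0..l}"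
    by (rule measurable_bounded_by_integrable_imp_absolutely_integrable[where g="\<lambda>_. B"])
       (use lip_prim_measurable[OF F] B in \<open>auto intro: integrable_const_ivl\<close>)
  define f' where "f' = (\<lambda>s. indicator {0..l} s *\<^sub>R f s)"
  have f': "integrable lebesgue f'" using abs unfolding set_integrable_def f'_def .
  have "AE s in lebesgue. f' s = 0"
  proof (rule AE_zero_if_integral_intervals_zero[OF f'])
    fix a b :: real
    have eq: "(LINT x:{a..b}|lebesgue. f' x) = (LINT x:{max 0 a..min l b}|lebesgue. f x)"
      unfolding set_lebesgue_integral_def f'_def
      by (intro Bochner_Integration.integral_cong) (auto simp: indicator_def)
    show "(LINT x:{a..b}|lebesgue. f' x) = 0"
    proof (cases "max 0 a \<le> min l b")
      case True
      have "f absolutely_integrable_on {max 0 a..min l b}"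
        using abs by (rule set_integrable_subset) auto
      then have "(LINT x:{max 0 a..min l b}|lebesgue. f x) = integral {max 0 a..min l b} f"
        by (rule set_lebesgue_integral_eq_integral)
      also have "\<dots> = F (min l b) - F (max 0 a)"
        using True by (intro integral_unique lip_prim_interval[OF F]) auto
      also have "\<dots> = 0" using 0[of "min l b"] 0[of "max 0 a"] True by auto
      finally show ?thesis using eq by simp
    next
      case False
      then show ?thesis using eq by (simp add: set_lebesgue_integral_def)
    qed
  qed
  then have "AE s in lebesgue. s \<in> {0..l} \<longrightarrow> f s = 0"
    by eventually_elim (auto simp: f'_def)
  then show ?thesis by (subst AE_restrict_space_iff) auto
qed

lemma AE_lip_prim_unique:
  fixes f :: "real \<Rightarrow> real"
  assumes "lip_prim l F f" "lip_prim l F g"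
  shows "AE s in lebesgue_on {0..l}. f s = g s"
proof -
  have "AE s in lebesgue_on {0..l}. f s - g s = 0"
    by (rule AE_zero_if_indefinite_integral_zero[OF lip_prim_diff[OF assms]]) simp
  then show ?thesis by simp
qed

lemma AE_deriv_zero_on_zero_set:
  fixes F f :: "real \<Rightarrow> real"
  assumes F: "lip_prim l F f"
  shows "AE s in lebesgue_on {0..l}. F s = 0 \<longrightarrow> f s = 0"
proof -
  obtain B where B: "B \<ge> 0" "\<And>s. s \<in> {0..l} \<Longrightarrow> norm (f s) \<le> B" using lip_prim_bounded_deriv[OF F] by blast
  \<comment> \<open>\<open>arctan (n F) / n\<close> tends to 0 uniformly, and its derivative \<open>f / (1 + (n F)\<^sup>2)\<close> tends to \<open>?f\<close>.\<close>
  let ?f = "\<lambda>s. if F s = 0 then f s else 0"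
  have "(?f has_integral 0) {0..t}" if t: "t \<in> {0..l}" for t
  proof (rule has_integral_dominated_convergence[where h = "\<lambda>_. B"
        and f = "\<lambda>n s. f s / (1 + (real (Suc n) * F s)\<^sup>2)"
        and y = "\<lambda>n. (arctan (real (Suc n) * F t) - arctan (real (Suc n) * F 0)) / real (Suc n)"])
    fix n :: nat
    have "lip_prim l (\<lambda>s. F s \<bullet> real (Suc n)) (\<lambda>s. f s \<bullet> real (Suc n))"
      by (rule lip_prim_inner_const[OF F])
    from lip_prim_arctan[OF this]
    have "((\<lambda>s. f s * real (Suc n) / (1 + (real (Suc n) * F s)\<^sup>2)) has_integral
       (arctan (real (Suc n) * F t) - arctan (real (Suc n) * F 0))) {0..t}"
      using t unfolding lip_prim_def by (simp add: mult.commute)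
    from has_integral_divide[OF this, of "real (Suc n)"]
    show "((\<lambda>s. f s / (1 + (real (Suc n) * F s)\<^sup>2)) has_integral
       (arctan (real (Suc n) * F t) - arctan (real (Suc n) * F 0)) / real (Suc n)) {0..t}" 
      by (simp del: of_nat_Suc)
    show "\<forall>s\<in>{0..t}. norm (f s / (1 + (real (Suc n) * F s)\<^sup>2)) \<le> B"
    proof
      fix s assume "s \<in> {0..t}"
      have "\<bar>f s\<bar> / (1 + (real (Suc n) * F s)\<^sup>2) \<le> \<bar>f s\<bar> / 1"
        by (intro divide_left_mono) (auto intro: add_pos_nonneg)
      then show "norm (f s / (1 + (real (Suc n) * F s)\<^sup>2)) \<le> B"
        using B(2)[of s] t \<open>s \<in> {0..t}\<close> by (auto simp: add_nonneg_nonneg)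
    qed
  next
    show "\<forall>s\<in>{0..t}. (\<lambda>n. f s / (1 + (real (Suc n) * F s)\<^sup>2)) \<longlonglongrightarrow> ?f s"
    proof
      fix s
      show "(\<lambda>n. f s / (1 + (real (Suc n) * F s)\<^sup>2)) \<longlonglongrightarrow> ?f s"
      proof (cases "F s = 0")
        case False
        have "filterlim (\<lambda>n. 1 + (real (Suc n) * F s)\<^sup>2) at_top sequentially"
        proof -
          have "filterlim (\<lambda>n. (F s)\<^sup>2 * real n) at_top sequentially"
            using False by (intro filterlim_tendsto_pos_mult_at_top[OF tendsto_const]) (auto intro: filterlim_real_sequentially)
          moreover have "(F s)\<^sup>2 * real n \<le> 1 + (real (Suc n) * F s)\<^sup>2" for n
          proof -
            have "real n \<le> (real (Suc n))\<^sup>2" by (simp add: power2_eq_square algebra_simps)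
            then have "(F s)\<^sup>2 * real n \<le> (F s)\<^sup>2 * (real (Suc n))\<^sup>2" by (intro mult_left_mono) auto
            then show ?thesis by (simp add: power_mult_distrib mult.commute)
          qed
          then have "\<forall>\<^sub>F n in sequentially. (F s)\<^sup>2 * real n \<le> 1 + (real (Suc n) * F s)\<^sup>2"
            by (rule always_eventually[OF allI])
          ultimately show ?thesis
            by (rule filterlim_at_top_mono)
        qed
        then have "(\<lambda>n. f s / (1 + (real (Suc n) * F s)\<^sup>2)) \<longlonglongrightarrow> 0"
          by (intro real_tendsto_divide_at_top[OF tendsto_const])
        then show ?thesis using False by simp
      qed simp
    qed
    have "(\<lambda>n. (arctan (real (Suc n) * F t) - arctan (real (Suc n) * F 0)) / real (Suc n)) \<longlonglongrightarrow> 0"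
    proof (rule tendsto_rabs_zero_cancel, rule tendsto_sandwich[of "\<lambda>_. 0"])
      have "\<bar>arctan x - arctan y\<bar> \<le> pi" for x y using arctan_bounded[of x] arctan_bounded[of y] by linarith
      then show "\<forall>\<^sub>F n in sequentially. \<bar>(arctan (real (Suc n) * F t) - arctan (real (Suc n) * F 0)) / real (Suc n)\<bar> \<le> pi / real (Suc n)"
        by (auto intro!: always_eventually divide_right_mono simp: abs_divide)
      show "(\<lambda>n. pi / real (Suc n)) \<longlonglongrightarrow> 0"
        using LIMSEQ_Suc[OF lim_const_over_n[of pi]] by simp
    qed auto
    then show "(\<lambda>n. (arctan (real (Suc n) * F t) - arctan (real (Suc n) * F 0)) / real (Suc n)) \<longlonglongrightarrow> 0" .
  qed (auto intro: integrable_const_ivl)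
  moreover have "\<forall>s\<in>{0..l}. norm (?f s) \<le> B" using B by auto
  \<comment> \<open>The zero function is thus a primitive of the truncated derivative
    \<open>?f\<close>, which therefore vanishes almost everywhere.\<close>
  ultimately have "lip_prim l (\<lambda>_. 0) ?f" unfolding lip_prim_def by (metis diff_zero)
  from AE_zero_if_indefinite_integral_zero[OF this]
  show ?thesis by (auto elim: eventually_mono split: if_splits)
qed

section \<open>Bounded measurable coefficients\<close>

definition bdd_measurable :: "real \<Rightarrow> (real \<Rightarrow> 'a::euclidean_space) \<Rightarrow> bool" where
  "bdd_measurable l f \<longleftrightarrow> f \<in> borel_measurable (lebesgue_on {0..l}) \<and> (\<exists>B. \<forall>s\<in>{0..l}. norm (f s) \<le> B)"

lemma bdd_measurable_const: "bdd_measurable l (\<lambda>_. c)"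
  unfolding bdd_measurable_def by auto

lemma bdd_measurable_add:
  assumes "bdd_measurable l f" "bdd_measurable l g" shows "bdd_measurable l (\<lambda>s. f s + g s)"
proof -
  obtain A B where "\<forall>s\<in>{0..l}. norm (f s) \<le> A" "\<forall>s\<in>{0..l}. norm (g s) \<le> B"
    using assms unfolding bdd_measurable_def by blast
  then have "\<forall>s\<in>{0..l}. norm (f s + g s) \<le> A + B" by (meson add_mono norm_triangle_ineq order_trans)
  then show ?thesis using assms unfolding bdd_measurable_def by (blast intro: borel_measurable_add)
qed

lemma bdd_measurable_scaleR:
  assumes "bdd_measurable l f" "bdd_measurable l g" shows "bdd_measurable l (\<lambda>s. f s *\<^sub>R g s)"
proof -
  obtain A B where AB: "\<forall>s\<in>{0..l}. norm (f s) \<le> A" "\<forall>s\<in>{0..l}. norm (g s) \<le> B"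
    using assms unfolding bdd_measurable_def by blast
  have "norm (f s *\<^sub>R g s) \<le> A * B" if "s \<in> {0..l}" for s
  proof -
    have "0 \<le> A" using order_trans[OF norm_ge_zero] AB(1) that by blast
    then show ?thesis unfolding norm_scaleR using AB that by (intro mult_mono) auto
  qed
  then show ?thesis using assms unfolding bdd_measurable_def by (blast intro: borel_measurable_scaleR)
qed

lemma bdd_measurable_mult:
  fixes f g :: "real \<Rightarrow> real"
  assumes "bdd_measurable l f" "bdd_measurable l g" shows "bdd_measurable l (\<lambda>s. f s * g s)"
  using bdd_measurable_scaleR[OF assms] by simp

lemma bdd_measurable_diff:
  assumes "bdd_measurable l f" "bdd_measurable l g" shows "bdd_measurable l (\<lambda>s. f s - g s)"
  using bdd_measurable_add[OF assms(1) bdd_measurable_scaleR[OF bdd_measurable_const[of l "-1"] assms(2)]] by simp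

lemma bdd_measurable_inner_const:
  assumes "bdd_measurable l f" shows "bdd_measurable l (\<lambda>s. f s \<bullet> c)"
proof -
  obtain B where B: "\<forall>s\<in>{0..l}. norm (f s) \<le> B"
    using assms unfolding bdd_measurable_def by blast
  have "norm (f s \<bullet> c) \<le> B * norm c" if "s \<in> {0..l}" for s
    using Cauchy_Schwarz_ineq2[of "f s" c] mult_right_mono[of "norm (f s)" B "norm c"] B that by fastforce
  moreover have "(\<lambda>s. f s \<bullet> c) \<in> borel_measurable (lebesgue_on {0..l})"
    using assms unfolding bdd_measurable_def by (intro borel_measurable_inner borel_measurable_const) blast
  ultimately show ?thesis unfolding bdd_measurable_def by blast
qed

lemma lip_prim_bdd_measurable:
  assumes "lip_prim l F f" shows "bdd_measurable l F" "bdd_measurable l f"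
proof -
  obtain A where "\<And>s. s \<in> {0..l} \<Longrightarrow> norm (F s) \<le> A" using lip_prim_bounded[OF assms] by blast
  then show "bdd_measurable l F" unfolding bdd_measurable_def
    using continuous_imp_measurable_on_sets_lebesgue[OF lip_prim_continuous_on[OF assms]] by (meson atLeastAtMost_borel sets_completionI_sets lborelD)
  show "bdd_measurable l f"
    using lip_prim_measurable[OF assms] assms unfolding bdd_measurable_def lip_prim_def by blast
qed

section \<open>Test functions\<close>

text \<open>This class of functions is closed under differentiation, hence consists of smooth functions.\<close>

definition flat_bump :: "real poly \<Rightarrow> real poly \<Rightarrow> nat \<Rightarrow> real \<Rightarrow> real" where
  "flat_bump r p m x = (if poly r x > 0 then poly p x / poly r x ^ m * exp (- 1 / poly r x) else 0)"

text \<open>The exponential series at \<open>1 / t\<close> dominates its term of index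
  \<open>m + 2\<close>. The two surplus powers leave \<open>t\<^sup>2\<close>, the decay used at the
  zeros of \<open>r\<close>.\<close>

lemma exp_minus_inverse_le:
  fixes t :: real assumes "t > 0"
  shows "exp (- 1 / t) / t ^ m \<le> fact (m + 2) * t\<^sup>2"
proof -
  have "(1 / t) ^ (m + 2) / fact (m + 2) \<le> exp (1 / t)"
  proof -
    have "sum (\<lambda>n. (1 / t) ^ n /\<^sub>R fact n) {m + 2} \<le> (\<Sum>n. (1 / t) ^ n /\<^sub>R fact n)"
      by (rule sum_le_suminf[OF summable_exp_generic]) (use assms in auto)
    then show ?thesis by (simp add: exp_def field_simps)
  qed
  then have "exp (- 1 / t) * ((1 / t) ^ (m + 2) / fact (m + 2)) \<le> exp (- 1 / t) * exp (1 / t)"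
    by (rule mult_left_mono) simp
  also have "\<dots> = 1" by (simp add: mult_exp_exp)
  finally have "exp (- 1 / t) * (1 / t) ^ (m + 2) / fact (m + 2) \<le> 1"
    by (simp only: times_divide_eq_right)
  then have "exp (- 1 / t) * (1 / t) ^ (m + 2) \<le> fact (m + 2)"
    by (simp only: divide_le_eq_1_pos[OF fact_gt_zero])
  then have "exp (- 1 / t) * (1 / t) ^ (m + 2) * t\<^sup>2 \<le> fact (m + 2) * t\<^sup>2"
    by (rule mult_right_mono) simp
  moreover have "exp (- 1 / t) * (1 / t) ^ (m + 2) * t\<^sup>2 = exp (- 1 / t) / t ^ m"
    using assms by (simp add: power_add power_one_over field_simps power2_eq_square)
  ultimately show ?thesis by simp
qed

text \<open>Where \<open>r > 0\<close> this is the quotient rule over the common denominator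
  \<open>r ^ (m + 2)\<close>; where \<open>r < 0\<close> the function is locally zero; at a zero of
  \<open>r\<close> the exponential decay makes the function of order \<open>r\<^sup>2\<close>, so
  the difference quotient tends to zero.\<close>

lemma flat_bump_deriv:
  "(flat_bump r p m has_real_derivative
     flat_bump r (pderiv p * r\<^sup>2 - of_nat m * p * r * pderiv r + p * pderiv r) (m + 2) x) (at x)"
proof -
  consider "poly r x > 0" | "poly r x < 0" | "poly r x = 0" by linarith
  then show ?thesis
  proof cases
    case 1
    define U where "U = (\<lambda>y. inverse (poly r y))"
    let ?u = "U x" and ?r' = "poly (pderiv r) x"
    have u: "poly r x * ?u = 1" using 1 by (simp add: U_def)
    \<comment> \<open>For \<open>m = 0\<close> the truncated exponent \<open>m - 1\<close> is
      harmless because of the factor \<open>real m\<close>.\<close>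
    have m: "real m * (?u ^ (m - 1) * ?u\<^sup>2) = real m * ?u ^ (m + 1)"
      by (cases m) (auto simp: power2_eq_square power_add)
    have "(U has_real_derivative - (?u * ?r' * ?u)) (at x)"
      unfolding U_def by (rule DERIV_inverse'[OF poly_DERIV]) (use 1 in auto)
    then have "((\<lambda>y. poly p y * U y ^ m * exp (- U y)) has_real_derivative
        poly (pderiv p) x * ?u ^ m * exp (- ?u) - poly p x * (real m * (?u ^ (m - 1) * ?u\<^sup>2)) * ?r' * exp (- ?u)
        + poly p x * ?u ^ m * ?u\<^sup>2 * ?r' * exp (- ?u)) (at x)"
      by (auto intro!: derivative_eq_intros poly_DERIV simp: algebra_simps power2_eq_square)
    \<comment> \<open>Each factor \<open>poly r x * ?u\<close> equals 1 and is inserted where needed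
      to bring all three terms to the denominator \<open>r ^ (m + 2)\<close>.\<close>
    also have "poly (pderiv p) x * ?u ^ m * exp (- ?u) - poly p x * (real m * (?u ^ (m - 1) * ?u\<^sup>2)) * ?r' * exp (- ?u)
        + poly p x * ?u ^ m * ?u\<^sup>2 * ?r' * exp (- ?u)
      = (poly (pderiv p) x * (poly r x * ?u)\<^sup>2 - real m * poly p x * (poly r x * ?u) * ?r' * ?u + poly p x * ?r' * ?u\<^sup>2)
        * ?u ^ m * exp (- ?u)"
      unfolding m u by (simp add: algebra_simps)
    also have "\<dots> = flat_bump r (pderiv p * r\<^sup>2 - of_nat m * p * r * pderiv r + p * pderiv r) (m + 2) x"
    proof -
      let ?N = "poly (pderiv p * r\<^sup>2 - of_nat m * p * r * pderiv r + p * pderiv r) x"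
      have "?N = poly (pderiv p) x * (poly r x)\<^sup>2 - real m * poly p x * poly r x * ?r' + poly p x * ?r'"
        by simp
      then have "(poly (pderiv p) x * (poly r x * ?u)\<^sup>2 - real m * poly p x * (poly r x * ?u) * ?r' * ?u
          + poly p x * ?r' * ?u\<^sup>2) * ?u ^ m * exp (- ?u) = ?N * ?u ^ (m + 2) * exp (- ?u)"
        by (simp only:) (simp add: power_mult_distrib power_add power2_eq_square algebra_simps)
      then show ?thesis using 1 by (simp only: flat_bump_def U_def power_inverse divide_inverse if_True mult_minus1)
    qed
    finally have "((\<lambda>y. poly p y * U y ^ m * exp (- U y)) has_real_derivative
        flat_bump r (pderiv p * r\<^sup>2 - of_nat m * p * r * pderiv r + p * pderiv r) (m + 2) x) (at x)" .
    moreover have "open {y. poly r y > 0}" by (intro open_Collect_less continuous_intros)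
    ultimately show ?thesis
      by (rule has_field_derivative_transform_within_open)
         (use 1 in \<open>auto simp: flat_bump_def U_def power_inverse divide_inverse\<close>)
  next
    case 2
    have "((\<lambda>_. 0) has_real_derivative
        flat_bump r (pderiv p * r\<^sup>2 - of_nat m * p * r * pderiv r + p * pderiv r) (m + 2) x) (at x)"
      using 2 by (simp add: flat_bump_def)
    moreover have "open {y. poly r y < 0}" by (intro open_Collect_less continuous_intros)
    ultimately show ?thesis
      by (rule has_field_derivative_transform_within_open) (use 2 in \<open>auto simp: flat_bump_def\<close>)
  next
    case 3
    have "bounded (poly p ` cball x 1)"
      by (intro compact_imp_bounded compact_continuous_image continuous_intros) auto
    then obtain A where A: "A > 0" "\<And>y. y \<in> cball x 1 \<Longrightarrow> \<bar>poly p y\<bar> \<le> A"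
      unfolding bounded_pos by auto
    let ?C = "A * fact (m + 2)"
    have bd: "\<bar>flat_bump r p m y\<bar> \<le> ?C * (poly r y)\<^sup>2" if "y \<in> cball x 1" for y
    proof (cases "poly r y > 0")
      case True
      have "\<bar>flat_bump r p m y\<bar> = \<bar>poly p y\<bar> * (exp (- 1 / poly r y) / poly r y ^ m)"
        using True by (simp add: flat_bump_def abs_mult abs_divide)
      also have "\<dots> \<le> A * (fact (m + 2) * (poly r y)\<^sup>2)"
        using True A that by (intro mult_mono exp_minus_inverse_le) auto
      finally show ?thesis by (simp only: mult.assoc)
    qed (use A in \<open>auto simp: flat_bump_def\<close>)
    have "((\<lambda>y. flat_bump r p m y / (y - x)) \<longlongrightarrow> 0) (at x)"
    \<comment> \<open>Since \<open>poly r x = 0\<close>, one factor of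
      \<open>(poly r y)\<^sup>2\<close> becomes a difference quotient, which converges, and the
      other still tends to zero.\<close>
    proof (rule Lim_null_comparison)
      have "\<forall>\<^sub>F y in at x. y \<in> cball x 1"
        by (auto simp: eventually_at dist_commute intro!: exI[of _ 1])
      then show "\<forall>\<^sub>F y in at x. norm (flat_bump r p m y / (y - x))
          \<le> ?C * \<bar>(poly r y - poly r x) / (y - x)\<bar> * \<bar>poly r y\<bar>"
      proof eventually_elim
        case (elim y)
        have "norm (flat_bump r p m y / (y - x)) \<le> ?C * (poly r y)\<^sup>2 / \<bar>y - x\<bar>"
          using bd[OF elim] by (simp add: divide_right_mono)
        also have "\<dots> = ?C * \<bar>(poly r y - poly r x) / (y - x)\<bar> * \<bar>poly r y\<bar>"
          using 3 by (simp add: power2_eq_square abs_divide)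
        finally show ?case .
      qed
      have "((\<lambda>y. (poly r y - poly r x) / (y - x)) \<longlongrightarrow> poly (pderiv r) x) (at x)"
        using poly_DERIV[of r x] by (simp add: has_field_derivative_iff)
      moreover have "((\<lambda>y. poly r y) \<longlongrightarrow> poly r x) (at x)"
        using DERIV_isCont[OF poly_DERIV[of r x]] by (simp add: isCont_def)
      ultimately have "((\<lambda>y. ?C * \<bar>(poly r y - poly r x) / (y - x)\<bar> * \<bar>poly r y\<bar>)
          \<longlongrightarrow> ?C * \<bar>poly (pderiv r) x\<bar> * \<bar>poly r x\<bar>) (at x)"
        by (intro tendsto_intros)
      then show "((\<lambda>y. ?C * \<bar>(poly r y - poly r x) / (y - x)\<bar> * \<bar>poly r y\<bar>) \<longlongrightarrow> 0) (at x)"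
        using 3 by simp
    qed
    then show ?thesis using 3 by (simp add: has_field_derivative_iff flat_bump_def)
  qed
qed

lemma smooth_fun_flat_bump: "smooth_fun (flat_bump r p m)"
proof -
  have "\<exists>q j. (deriv ^^ n) (flat_bump r p m) = flat_bump r q j" for n
  proof (induction n)
    case (Suc n)
    then obtain q j where "(deriv ^^ n) (flat_bump r p m) = flat_bump r q j" by blast
    moreover have "deriv (flat_bump r q j) =
        flat_bump r (pderiv q * r\<^sup>2 - of_nat j * q * r * pderiv r + q * pderiv r) (j + 2)"
      by (rule ext, rule DERIV_imp_deriv, rule flat_bump_deriv)
    ultimately show ?case by auto
  qed auto
  then show ?thesis
    unfolding smooth_fun_def using flat_bump_deriv real_differentiable_def by metis
qed

lemma smooth_fun_differentiable: "smooth_fun \<phi> \<Longrightarrow> (\<phi> has_real_derivative deriv \<phi> x) (at x)"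
  unfolding smooth_fun_def
  by (metis DERIV_deriv_iff_real_differentiable funpow_0)

lemma smooth_fun_deriv: "smooth_fun \<phi> \<Longrightarrow> smooth_fun (deriv \<phi>)"
  unfolding smooth_fun_def by (metis comp_apply funpow_Suc_right)

lemma smooth_fun_antideriv:
  assumes "smooth_fun \<theta>" "\<And>x. (\<phi> has_real_derivative \<theta> x) (at x)"
  shows "smooth_fun \<phi>"
  unfolding smooth_fun_def
proof (intro allI)
  fix m x
  have d: "deriv \<phi> = \<theta>" using assms(2) by (auto intro: DERIV_imp_deriv)
  show "(deriv ^^ m) \<phi> differentiable at x"
  proof (cases m)
    case 0
    then show ?thesis using assms(2) real_differentiable_def by auto
  next
    case (Suc k)
    then show ?thesis using assms(1) d unfolding smooth_fun_def by (simp add: funpow_Suc_right del: funpow.simps)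
  qed
qed

lemma smooth_fun_lin_comb:
  assumes "smooth_fun \<phi>" "smooth_fun \<psi>"
  shows "smooth_fun (\<lambda>x. \<phi> x - c * \<psi> x)"
proof -
  have eq: "(deriv ^^ m) (\<lambda>x. \<phi> x - c * \<psi> x) = (\<lambda>x. (deriv ^^ m) \<phi> x - c * (deriv ^^ m) \<psi> x)" for m
  proof (induction m)
    case (Suc m)
    have "deriv (\<lambda>x. (deriv ^^ m) \<phi> x - c * (deriv ^^ m) \<psi> x) x = deriv ((deriv ^^ m) \<phi>) x - c * deriv ((deriv ^^ m) \<psi>) x" for x
    proof (rule DERIV_imp_deriv)
      have "((deriv ^^ m) \<phi> has_real_derivative deriv ((deriv ^^ m) \<phi>) x) (at x)"
        "((deriv ^^ m) \<psi> has_real_derivative deriv ((deriv ^^ m) \<psi>) x) (at x)"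
        using assms unfolding smooth_fun_def by (simp_all add: DERIV_deriv_iff_real_differentiable)
      then show "((\<lambda>x. (deriv ^^ m) \<phi> x - c * (deriv ^^ m) \<psi> x) has_real_derivative
          deriv ((deriv ^^ m) \<phi>) x - c * deriv ((deriv ^^ m) \<psi>) x) (at x)"
        by (intro DERIV_diff DERIV_cmult)
    qed
    then show ?case using Suc by auto
  qed auto
  show ?thesis
    unfolding smooth_fun_def eq
  proof (intro allI)
    fix m x
    show "(\<lambda>x. (deriv ^^ m) \<phi> x - c * (deriv ^^ m) \<psi> x) differentiable at x"
      using assms unfolding smooth_fun_def by (intro derivative_intros) auto
  qed
qed

lemma test_funI:
  assumes "smooth_fun \<phi>" "0 < a" "b < l" "\<And>x. x \<notin> {a..b} \<Longrightarrow> \<phi> x = 0"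
  shows "test_fun l \<phi>"
  unfolding test_fun_def using assms by blast

lemma test_fun_lin_comb:
  assumes "test_fun l \<phi>" "test_fun l \<psi>"
  shows "test_fun l (\<lambda>x. \<phi> x - c * \<psi> x)"
proof -
  obtain a b where ab: "0 < a" "b < l" "\<And>x. x \<notin> {a..b} \<Longrightarrow> \<phi> x = 0"
    using assms(1) unfolding test_fun_def by blast
  obtain a' b' where ab': "0 < a'" "b' < l" "\<And>x. x \<notin> {a'..b'} \<Longrightarrow> \<psi> x = 0"
    using assms(2) unfolding test_fun_def by blast
  show ?thesis
  proof (rule test_funI)
    show "smooth_fun (\<lambda>x. \<phi> x - c * \<psi> x)" using assms by (auto simp: test_fun_def intro: smooth_fun_lin_comb)
    show "\<phi> x - c * \<psi> x = 0" if "x \<notin> {min a a'..max b b'}" for x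
    proof -
      have "x \<notin> {a..b}" "x \<notin> {a'..b'}" using that by auto
      then show ?thesis using ab(3) ab'(3) by simp
    qed
  qed (use ab ab' in auto)
qed

lemma test_fun_zero: assumes "l > 0" shows "test_fun l (\<lambda>_. 0)"
proof -
  \<comment> \<open>No value of the zero polynomial is positive, so this bump is the zero
    function.\<close>
  have "test_fun l (flat_bump 0 0 0)"
    by (rule test_funI[OF smooth_fun_flat_bump, of "l/2" "l/2"]) (use assms in \<open>auto simp: flat_bump_def\<close>)
  then show ?thesis by (simp add: flat_bump_def[abs_def])
qed

lemma test_fun_differentiable: "test_fun l \<phi> \<Longrightarrow> (\<phi> has_real_derivative deriv \<phi> x) (at x)"
  by (simp add: test_fun_def smooth_fun_differentiable)

lemma test_fun_continuous: "test_fun l \<phi> \<Longrightarrow> continuous_on S \<phi>"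
  by (intro continuous_at_imp_continuous_on ballI) (metis DERIV_isCont test_fun_differentiable)

lemma test_fun_deriv_continuous: "test_fun l \<phi> \<Longrightarrow> continuous_on S (deriv \<phi>)"
  by (intro continuous_at_imp_continuous_on ballI)
     (metis DERIV_isCont smooth_fun_differentiable smooth_fun_deriv test_fun_def)

lemma test_fun_ends:
  assumes "test_fun l \<phi>" "s \<le> 0 \<or> l \<le> s" shows "\<phi> s = 0"
  using assms unfolding test_fun_def by force

text \<open>The integral condition makes the primitive return to zero to the right of the support;
  normalisation at \<open>0\<close> makes it vanish to the left.\<close>

lemma test_fun_antideriv:
  assumes \<theta>: "test_fun l \<theta>" and I: "(\<theta> has_integral 0) {0..l}" and l: "l > 0"
  obtains \<phi> where "test_fun l \<phi>" "deriv \<phi> = \<theta>"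
proof -
  obtain a b where ab: "0 < a" "b < l" "\<And>x. x \<notin> {a..b} \<Longrightarrow> \<theta> x = 0"
    using \<theta> unfolding test_fun_def by blast
  have "isCont \<theta> x" for x using test_fun_differentiable[OF \<theta>] DERIV_isCont by blast
  \<comment> \<open>The primitive is taken on the whole line, since smoothness and vanishing of test
    functions refer to all real arguments.\<close>
  then obtain \<Phi> where \<Phi>: "\<And>x. (\<Phi> has_vector_derivative \<theta> x) (at x)"
    using einterval_antiderivative[of "-\<infinity>" "\<infinity>" \<theta>] by auto
  define \<phi> where "\<phi> = (\<lambda>x. \<Phi> x - \<Phi> 0)"
  have D: "(\<phi> has_real_derivative \<theta> x) (at x)" for x
    unfolding \<phi>_def using \<Phi>[of x]
    by (auto simp: has_real_derivative_iff_has_vector_derivative intro!: derivative_eq_intros)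
  have const: "\<phi> y = \<phi> x" if "x \<le> y" "\<And>z. x \<le> z \<Longrightarrow> z \<le> y \<Longrightarrow> \<theta> z = 0" for x y
  proof -
    have "(\<theta> has_integral \<phi> y - \<phi> x) {x..y}"
      using that(1) D by (intro fundamental_theorem_of_calculus)
        (auto simp: has_real_derivative_iff_has_vector_derivative intro: has_vector_derivative_at_within)
    moreover have "(\<theta> has_integral 0) {x..y}" by (rule has_integral_is_0) (use that in auto)
    ultimately have "\<phi> y - \<phi> x = 0" by (rule has_integral_unique)
    then show ?thesis by simp
  qed
  have "\<phi> l = 0"
  proof -
    have "(\<theta> has_integral \<phi> l - \<phi> 0) {0..l}"
      using l D by (intro fundamental_theorem_of_calculus)
        (auto simp: has_real_derivative_iff_has_vector_derivative intro: has_vector_derivative_at_within)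
    then have "\<phi> l - \<phi> 0 = 0" using I by (rule has_integral_unique)
    then show ?thesis by (simp add: \<phi>_def)
  qed
  have "\<phi> x = 0" if "x \<notin> {a..b}" for x
  proof (cases "x < a")
    case True
    have 0: "\<theta> z = 0" if "z < a" for z using ab(3)[of z] that by simp
    have "\<phi> 0 = \<phi> x" if "x \<le> 0"
      by (rule const[OF that]) (use 0 ab(1) in simp)
    moreover have "\<phi> x = \<phi> 0" if "0 \<le> x"
      by (rule const[OF that]) (use 0 True in simp)
    ultimately have "\<phi> x = \<phi> 0" by force
    then show ?thesis by (simp add: \<phi>_def)
  next
    case False
    then have "b < x" using that by simp
    have 0: "\<theta> z = 0" if "b < z" for z using ab(3)[of z] that by simp
    have "\<phi> l = \<phi> x" if "x \<le> l"
      by (rule const[OF that]) (use 0 \<open>b < x\<close> in simp)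
    moreover have "\<phi> x = \<phi> l" if "l \<le> x"
      by (rule const[OF that]) (use 0 ab(2) in simp)
    ultimately have "\<phi> x = \<phi> l" by force
    then show ?thesis using \<open>\<phi> l = 0\<close> by simp
  qed
  moreover have "smooth_fun \<phi>" using \<theta> D by (auto simp: test_fun_def intro: smooth_fun_antideriv)
  ultimately have "test_fun l \<phi>" unfolding test_fun_def using ab by blast
  moreover have "deriv \<phi> = \<theta>" using D by (auto intro: DERIV_imp_deriv)
  ultimately show ?thesis by (rule that)
qed

lemma test_fun_approx_indicator:
  assumes "0 < a" "a < b" "b < l"
  shows "\<exists>\<psi>. \<forall>n. test_fun l (\<psi> n) \<and> (\<forall>x. 0 \<le> \<psi> n x \<and> \<psi> n x \<le> 1) \<and>
    (\<forall>x\<in>{a<..<b}. 0 < \<psi> n x) \<and> (\<forall>x. (\<lambda>n. \<psi> n x) \<longlonglongrightarrow> indicator {a<..<b} x)"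
proof -
  \<comment> \<open>The polynomial \<open>(n + 1) (x - a) (b - x)\<close> is positive exactly on the
    open interval; growing with \<open>n\<close>, it drives \<open>exp (- 1 / r)\<close> to 1
    there.\<close>
  define r where "r = (\<lambda>n. smult (real (Suc n)) ([:-a, 1:] * [:b, -1:]))"
  define \<psi> where "\<psi> = (\<lambda>n. flat_bump (r n) 1 0)"
  have r: "poly (r n) x = real (Suc n) * ((x - a) * (b - x))" for n x
    unfolding r_def by (simp add: algebra_simps)
  have pos: "poly (r n) x > 0 \<longleftrightarrow> x \<in> {a<..<b}" for n x
    unfolding r using assms(2) by (auto simp: zero_less_mult_iff simp del: of_nat_Suc)
  have val: "\<psi> n x = (if x \<in> {a<..<b} then exp (- 1 / poly (r n) x) else 0)" for n x
    unfolding \<psi>_def flat_bump_def pos by simp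
  show ?thesis
  proof (intro exI[of _ \<psi>] allI conjI ballI)
    show "test_fun l (\<psi> n)" for n
    proof (rule test_funI)
      show "smooth_fun (\<psi> n)" unfolding \<psi>_def by (rule smooth_fun_flat_bump)
    qed (use assms in \<open>auto simp: val\<close>)
    show "0 \<le> \<psi> n x" "x \<in> {a<..<b} \<Longrightarrow> 0 < \<psi> n x" for n x by (auto simp: val)
    show "\<psi> n x \<le> 1" for n x using pos[of n x] by (auto simp: val)
    show "(\<lambda>n. \<psi> n x) \<longlonglongrightarrow> indicator {a<..<b} x" for x
    proof (cases "x \<in> {a<..<b}")
      case True
      have "(\<lambda>n. (- 1 / ((x - a) * (b - x))) / real (Suc n)) \<longlonglongrightarrow> 0"
        using LIMSEQ_Suc[OF lim_const_over_n] by fast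
      then have "(\<lambda>n. exp ((- 1 / ((x - a) * (b - x))) / real (Suc n))) \<longlonglongrightarrow> exp 0"
        by (rule tendsto_exp)
      moreover have "(- 1 / ((x - a) * (b - x))) / real (Suc n) = - 1 / poly (r n) x" for n
        unfolding r by (simp add: mult.commute del: of_nat_Suc)
      ultimately show ?thesis using True by (simp add: val)
    next
      case False
      then have "\<psi> n x = 0" for n unfolding val by (rule if_not_P)
      then show ?thesis using False by simp
    qed
  qed
qed

section \<open>Weak derivatives\<close>

lemma lip_prim_test_fun:
  assumes "test_fun l \<phi>" shows "lip_prim l \<phi> (deriv \<phi>)"
  unfolding lip_prim_def
proof (intro conjI ballI)
  show "(deriv \<phi> has_integral \<phi> s - \<phi> 0) {0..s}" if "s \<in> {0..l}" for s
    using that test_fun_differentiable[OF assms] by (intro fundamental_theorem_of_calculus)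
      (auto simp: has_real_derivative_iff_has_vector_derivative intro: has_vector_derivative_at_within)
  have "bounded (deriv \<phi> ` {0..l})"
    by (intro compact_imp_bounded compact_continuous_image test_fun_deriv_continuous[OF assms]) auto
  then show "\<exists>B. \<forall>s\<in>{0..l}. norm (deriv \<phi> s) \<le> B" unfolding bounded_iff by blast
qed

lemma test_fun_measurable:
  assumes "test_fun l \<phi>" shows "\<phi> \<in> borel_measurable (lebesgue_on {0..l})"
  by (intro continuous_imp_measurable_on_sets_lebesgue test_fun_continuous[OF assms]) auto

text \<open>A test function with vanishing mean is the derivative of another. Subtracting a multiple
  of one fixed bump achieves this, so \<open>r - c\<close> annihilates all test functions; letting
  these tend to indicators makes its primitive constant.\<close>

lemma du_bois_reymond_constant:
  fixes r :: "real \<Rightarrow> real"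
  assumes l: "l > 0" and meas: "r \<in> borel_measurable (lebesgue_on {0..l})"
    and bd: "\<And>s. s \<in> {0..l} \<Longrightarrow> norm (r s) \<le> R"
    and weak: "\<And>\<phi>. test_fun l \<phi> \<Longrightarrow> ((\<lambda>s. r s * deriv \<phi> s) has_integral 0) {0..l}"
  obtains c where "AE s in lebesgue_on {0..l}. r s = c"
proof -
  have R: "R \<ge> 0" using order_trans[OF norm_ge_zero bd[of 0]] l by simp
  have ab: "0 < l/3" "l/3 < 2*l/3" "2*l/3 < l" using l by auto
  obtain \<psi>0 where \<psi>0: "test_fun l \<psi>0" "\<And>x. 0 \<le> \<psi>0 x" "\<forall>x\<in>{l/3<..<2*l/3}. 0 < \<psi>0 x"
    using test_fun_approx_indicator[OF ab] by blast
  have int: "\<psi> integrable_on {0..l}" if "test_fun l \<psi>" for \<psi>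
    by (intro integrable_continuous_interval test_fun_continuous[OF that])
  define I where "I = integral {0..l} \<psi>0"
  have "I \<noteq> 0"
  proof
    assume "I = 0"
    then have "\<psi>0 x = 0" if "x \<in> {0..l}" for x
      unfolding I_def
      using integral_eq_0_iff[of 0 l \<psi>0] l \<psi>0(2) test_fun_continuous[OF \<psi>0(1)] that by blast
    moreover have "0 < \<psi>0 (l/2)" using \<psi>0(3) l by simp
    ultimately show False using l by simp
  qed
  have rint: "(\<lambda>s. r s * \<psi> s) integrable_on {0..l}" if \<psi>: "test_fun l \<psi>" for \<psi>
  proof -
    obtain B where B: "B \<ge> 0" "\<And>s. s \<in> {0..l} \<Longrightarrow> norm (\<psi> s) \<le> B"
      using lip_prim_bounded[OF lip_prim_test_fun[OF \<psi>]] by blast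
    show ?thesis
    proof (rule bounded_measurable_integrable)
      show "(\<lambda>s. r s * \<psi> s) \<in> borel_measurable (lebesgue_on {0..l})"
        by (intro borel_measurable_times meas test_fun_measurable[OF \<psi>])
      show "norm (r s * \<psi> s) \<le> R * B" if "s \<in> {0..l}" for s
        unfolding norm_mult using bd B that R by (intro mult_mono) auto
    qed auto
  qed
  \<comment> \<open>The weighted mean of \<open>r\<close> against \<open>\<psi>0\<close>, the only
    possible value of the constant.\<close>
  define c where "c = integral {0..l} (\<lambda>s. r s * \<psi>0 s) / I"
  have test: "((\<lambda>s. (r s - c) * \<psi> s) has_integral 0) {0..l}" if \<psi>: "test_fun l \<psi>" for \<psi>
  proof -
    let ?k = "integral {0..l} \<psi> / I"
    have \<theta>: "test_fun l (\<lambda>s. \<psi> s - ?k * \<psi>0 s)" by (rule test_fun_lin_comb[OF \<psi> \<psi>0(1)])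
    have "((\<lambda>s. \<psi> s - ?k * \<psi>0 s) has_integral (integral {0..l} \<psi> - ?k * I)) {0..l}"
      unfolding I_def using int[OF \<psi>] int[OF \<psi>0(1)]
      by (intro has_integral_diff has_integral_mult_right integrable_integral)
    then have "((\<lambda>s. \<psi> s - ?k * \<psi>0 s) has_integral 0) {0..l}" using \<open>I \<noteq> 0\<close> by simp
    then obtain \<phi> where \<phi>: "test_fun l \<phi>" "deriv \<phi> = (\<lambda>s. \<psi> s - ?k * \<psi>0 s)"
      using test_fun_antideriv[OF \<theta> _ l] by blast
    have 1: "((\<lambda>s. r s * (\<psi> s - ?k * \<psi>0 s)) has_integral 0) {0..l}"
      using weak[OF \<phi>(1)] \<phi>(2) by simp
    \<comment> \<open>Here \<open>(r - c) \<psi>\<close> is split into \<open>r\<close> times the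
      mean-free test function plus this remainder, whose integral vanishes by the choice of
      \<open>c\<close>.\<close>
    have "((\<lambda>s. ?k * (r s * \<psi>0 s) - c * \<psi> s) has_integral
        ?k * integral {0..l} (\<lambda>s. r s * \<psi>0 s) - c * integral {0..l} \<psi>) {0..l}"
      using int[OF \<psi>] rint[OF \<psi>0(1)]
      by (intro has_integral_diff has_integral_mult_right integrable_integral)
    then have 2: "((\<lambda>s. ?k * (r s * \<psi>0 s) - c * \<psi> s) has_integral 0) {0..l}"
      by (simp add: c_def)
    show ?thesis using has_integral_add[OF 1 2] by (simp add: algebra_simps)
  qed
  define D where "D = (\<lambda>s. integral {0..s} (\<lambda>s. r s - c))"
  have bd': "norm (r s - c) \<le> R + \<bar>c\<bar>" if "s \<in> {0..l}" for s
    using bd[OF that] norm_triangle_ineq4[of "r s" c] by simp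
  have meas': "(\<lambda>s. r s - c) \<in> borel_measurable (lebesgue_on {0..l})" using meas by simp
  have D: "lip_prim l D (\<lambda>s. r s - c)"
    unfolding D_def by (rule lip_prim_integral[OF meas' bd'])
  have Deq: "D b = D a" if ab: "0 < a" "a < b" "b < l" for a b
  proof -
    obtain \<psi> where \<psi>: "\<forall>n. test_fun l (\<psi> n) \<and> (\<forall>x. 0 \<le> \<psi> n x \<and> \<psi> n x \<le> 1) \<and>
        (\<forall>x\<in>{a<..<b}. 0 < \<psi> n x) \<and> (\<forall>x. (\<lambda>n. \<psi> n x) \<longlonglongrightarrow> indicator {a<..<b} x)"
      using test_fun_approx_indicator[OF ab] ..
    have "((\<lambda>s. (r s - c) * indicator {a<..<b} s) has_integral 0) {0..l}"
    proof (rule has_integral_dominated_convergence)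
      show "((\<lambda>s. (r s - c) * \<psi> n s) has_integral 0) {0..l}" for n by (rule test) (use \<psi> in blast)
      show "(\<lambda>_. R + \<bar>c\<bar>) integrable_on {0..l}" by (rule integrable_const_ivl)
      show "\<forall>s\<in>{0..l}. norm ((r s - c) * \<psi> n s) \<le> R + \<bar>c\<bar>" for n
      proof
        fix s assume "s \<in> {0..l}"
        moreover have "norm (\<psi> n s) \<le> 1" using \<psi> by (simp add: abs_le_iff order_trans[OF _ zero_le_one])
        ultimately have "norm (r s - c) * norm (\<psi> n s) \<le> (R + \<bar>c\<bar>) * 1"
          using bd' R by (intro mult_mono) auto
        then show "norm ((r s - c) * \<psi> n s) \<le> R + \<bar>c\<bar>" by (simp add: abs_mult)
      qed
      show "\<forall>s\<in>{0..l}. (\<lambda>n. (r s - c) * \<psi> n s) \<longlonglongrightarrow> (r s - c) * indicator {a<..<b} s"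
        using \<psi> by (intro ballI tendsto_mult tendsto_const) blast
    qed simp
    moreover have "(\<lambda>s. (r s - c) * indicator {a<..<b} s) = (\<lambda>s. if s \<in> {a<..<b} then r s - c else 0)"
      by (auto simp: indicator_def)
    ultimately have "((\<lambda>s. if s \<in> {a<..<b} then r s - c else 0) has_integral 0) {0..l}" by simp
    moreover have "{a<..<b} \<subseteq> {0..l}" using ab by auto
    ultimately have "((\<lambda>s. r s - c) has_integral 0) {a<..<b}"
      by (simp only: has_integral_restrict)
    then have "((\<lambda>s. r s - c) has_integral 0) {a..b}" by (simp only: has_integral_Icc_iff_Ioo)
    moreover have "((\<lambda>s. r s - c) has_integral (D b - D a)) {a..b}"
      by (rule lip_prim_interval[OF D]) (use ab in auto)
    ultimately have "0 = D b - D a" by (rule has_integral_unique)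
    then show ?thesis by simp
  qed
  \<comment> \<open>The comparison of \<open>D\<close> covers interior points only, because test
    functions vanish near the ends; continuity reaches \<open>0\<close> and
    \<open>l\<close>.\<close>
  have const: "D s = D (l/2)" if "s \<in> {0..l}" for s
  proof (rule continuous_constant_on_closure[where f = D and S = "{0<..<l}"])
    show "continuous_on (closure {0<..<l}) D" using lip_prim_continuous_on[OF D] l by simp
    show "s \<in> closure {0<..<l}" using that l by simp
    show "D x = D (l/2)" if "x \<in> {0<..<l}" for x
    proof (cases x "l/2" rule: linorder_cases)
      case less
      then show ?thesis using Deq[of x "l/2"] that l by simp
    next
      case equal
      then show ?thesis by (rule arg_cong)
    next
      case greater
      then show ?thesis using Deq[of "l/2" x] that l by simp
    qed
  qed
  have "D s = D 0" if "s \<in> {0..l}" for s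
    using const[OF that] const[of 0] l by simp
  then have "AE s in lebesgue_on {0..l}. r s - c = 0"
    by (rule AE_zero_if_indefinite_integral_zero[OF D])
  then show ?thesis using that[of c] by simp
qed

text \<open>Integrating \<open>q \<phi>\<close> by parts with a primitive \<open>Q\<close> of
  \<open>q\<close> shows that \<open>p - Q\<close> has zero weak derivative, so \<open>p\<close> is
  \<open>Q\<close> plus a constant almost everywhere.\<close>

lemma du_bois_reymond:
  fixes p q :: "real \<Rightarrow> real"
  assumes l: "l > 0" and p: "bdd_measurable l p" and q: "bdd_measurable l q"
    and weak: "\<And>\<phi>. test_fun l \<phi> \<Longrightarrow> ((\<lambda>s. p s * deriv \<phi> s + q s * \<phi> s) has_integral 0) {0..l}"
  shows "\<exists>P. lip_prim l P q \<and> (AE s in lebesgue_on {0..l}. p s = P s)"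
proof -
  define Q where "Q = (\<lambda>s. integral {0..s} q)"
  have Q: "lip_prim l Q q"
  proof -
    obtain B where B: "\<forall>s\<in>{0..l}. norm (q s) \<le> B" using q unfolding bdd_measurable_def by blast
    show ?thesis unfolding Q_def
      by (rule lip_prim_integral[of q l B]) (use q B in \<open>auto simp: bdd_measurable_def\<close>)
  qed
  obtain A where A: "(\<lambda>s. p s - Q s) \<in> borel_measurable (lebesgue_on {0..l})"
      "\<forall>s\<in>{0..l}. norm (p s - Q s) \<le> A"
    using bdd_measurable_diff[OF p lip_prim_bdd_measurable(1)[OF Q]] unfolding bdd_measurable_def by blast
  obtain c where c: "AE s in lebesgue_on {0..l}. p s - Q s = c"
  proof (rule du_bois_reymond_constant[OF l A(1)])
    show "norm (p s - Q s) \<le> A" if "s \<in> {0..l}" for s using A(2) that by blast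
    show "((\<lambda>s. (p s - Q s) * deriv \<phi> s) has_integral 0) {0..l}" if \<phi>: "test_fun l \<phi>" for \<phi>
    proof -
      have "((\<lambda>s. q s * \<phi> s + Q s * deriv \<phi> s) has_integral (Q l * \<phi> l - Q 0 * \<phi> 0)) {0..l}"
        using lip_prim_interval[OF lip_prim_inner[OF Q lip_prim_test_fun[OF \<phi>]], of 0 l] l by simp
      then have "((\<lambda>s. q s * \<phi> s + Q s * deriv \<phi> s) has_integral 0) {0..l}"
        using test_fun_ends[OF \<phi>, of 0] test_fun_ends[OF \<phi>, of l] by simp
      from has_integral_diff[OF weak[OF \<phi>] this] show ?thesis by (simp add: algebra_simps)
    qed
  qed
  have "lip_prim l (\<lambda>s. Q s + c) q" using Q unfolding lip_prim_def by simp
  moreover have "AE s in lebesgue_on {0..l}. p s = Q s + c"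
    using c by eventually_elim simp
  ultimately show ?thesis by blast
qed

section \<open>Functions of bounded variation\<close>

definition variation_sum :: "(real \<Rightarrow> real) \<Rightarrow> real list \<Rightarrow> real" where
  "variation_sum f ts = (\<Sum>i<length ts - 1. \<bar>f (ts ! Suc i) - f (ts ! i)\<bar>)"

lemma variation_sum_snoc:
  assumes "ts \<noteq> []"
  shows "variation_sum f (ts @ [t]) = variation_sum f ts + \<bar>f t - f (last ts)\<bar>"
proof -
  obtain n where n: "length ts = Suc n" using assms by (cases ts) auto
  have "(\<Sum>i<n. \<bar>f ((ts @ [t]) ! Suc i) - f ((ts @ [t]) ! i)\<bar>) = (\<Sum>i<n. \<bar>f (ts ! Suc i) - f (ts ! i)\<bar>)"
    by (rule sum.cong) (auto simp: nth_append n)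
  then show ?thesis using assms by (simp add: variation_sum_def n nth_append last_conv_nth)
qed

text \<open>Jordan decomposition: with the variation function \<open>V\<close>, both
  \<open>V\<close> and \<open>V - f\<close> are monotone, and \<open>f\<close> is their
  difference.\<close>

lemma bounded_variation_measurable:
  assumes "bounded_variation_on l f"
  shows "f \<in> borel_measurable (lebesgue_on {0..l})"
proof -
  obtain B where B: "\<And>ts. sorted ts \<Longrightarrow> set ts \<subseteq> {0..l} \<Longrightarrow> variation_sum f ts \<le> B"
    using assms unfolding bounded_variation_on_def variation_sum_def by blast
  define S where "S = (\<lambda>t. variation_sum f ` {ts. sorted ts \<and> set ts \<subseteq> {0..t}})"
  define V where "V = (\<lambda>t. Sup (S t))"
  have V: "V s + \<bar>f t - f s\<bar> \<le> V t" if st: "0 \<le> s" "s \<le> t" "t \<le> l" for s t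
  proof -
    have bdd: "bdd_above (S t)"
      unfolding S_def using B st(3) by (intro bdd_aboveI2[where M = B]) fastforce
    have "V s \<le> V t - \<bar>f t - f s\<bar>"
      unfolding V_def
    proof (rule cSup_least)
      show "S s \<noteq> {}" unfolding S_def by (auto intro: exI[of _ "[]"])
      fix x assume "x \<in> S s"
      then obtain ts where ts: "sorted ts" "set ts \<subseteq> {0..s}" "x = variation_sum f ts" unfolding S_def by auto
      \<comment> \<open>Ending the partition at \<open>s\<close> before adding \<open>t\<close>
        makes the last jump exactly the one from \<open>s\<close> to \<open>t\<close>.\<close>
      have "variation_sum f ts \<le> variation_sum f (ts @ [s])"
        by (cases "ts = []") (simp_all add: variation_sum_snoc, simp add: variation_sum_def)
      also have "\<dots> + \<bar>f t - f s\<bar> = variation_sum f ((ts @ [s]) @ [t])"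
        by (subst variation_sum_snoc[of "ts @ [s]"]) auto
      finally have "x + \<bar>f t - f s\<bar> \<le> variation_sum f ((ts @ [s]) @ [t])" using ts(3) by simp
      also have "\<dots> \<in> S t"
        unfolding S_def using ts st by (intro imageI) (auto simp: sorted_append subset_iff)
      then have "variation_sum f ((ts @ [s]) @ [t]) \<le> Sup (S t)" using bdd by (rule cSup_upper)
      finally show "x \<le> Sup (S t) - \<bar>f t - f s\<bar>" by simp
    qed
    then show ?thesis by simp
  qed
  have "mono_on {0..l} V"
  proof (rule mono_onI)
    show "V s \<le> V t" if "s \<in> {0..l}" "t \<in> {0..l}" "s \<le> t" for s t
      using V[of s t] that by simp
  qed
  moreover have "mono_on {0..l} (\<lambda>t. V t - f t)"
  proof (rule mono_onI)
    show "V s - f s \<le> V t - f t" if "s \<in> {0..l}" "t \<in> {0..l}" "s \<le> t" for s t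
      using V[of s t] that abs_ge_self[of "f t - f s"] by simp
  qed
  ultimately have "V \<in> borel_measurable (restrict_space borel {0..l})"
    "(\<lambda>t. V t - f t) \<in> borel_measurable (restrict_space borel {0..l})"
    by (auto intro: borel_measurable_mono_on_fnc)
  then have "(\<lambda>t. V t - (V t - f t)) \<in> borel_measurable (restrict_space borel {0..l})"
    by (rule borel_measurable_diff)
  then have f: "f \<in> borel_measurable (restrict_space borel {0..l})" by simp
  have "sets (restrict_space borel {0..l}) \<subseteq> sets (lebesgue_on {0..l})"
    by (rule mono_restrict_space) auto
  then show ?thesis
    by (rule borel_measurable_subalgebra[OF _ _ f]) (simp add: space_restrict_space)
qed

lemma bounded_variation_bounded:
  assumes "bounded_variation_on l f" "0 \<le> l"
  obtains A where "\<And>s. s \<in> {0..l} \<Longrightarrow> \<bar>f s\<bar> \<le> A"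
proof -
  obtain B where B: "\<And>ts. sorted ts \<Longrightarrow> set ts \<subseteq> {0..l} \<Longrightarrow> variation_sum f ts \<le> B"
    using assms unfolding bounded_variation_on_def variation_sum_def by blast
  have "\<bar>f s\<bar> \<le> \<bar>f 0\<bar> + B" if "s \<in> {0..l}" for s
  proof -
    have "variation_sum f [0, s] \<le> B" using that assms(2) by (intro B) auto
    then have "\<bar>f s - f 0\<bar> \<le> B" by (simp add: variation_sum_def)
    then show ?thesis by linarith
  qed
  then show ?thesis by (rule that)
qed

section \<open>Minimality\<close>

text \<open>Replacing \<open>g\<close> by \<open>max f g\<close> changes no integral and turns the
  almost-everywhere inequality into a pointwise one.\<close>

lemma has_integral_le_AE:
  fixes f g :: "real \<Rightarrow> real"
  assumes "(f has_integral i) S" "(g has_integral j) S" "AE x in lebesgue_on S. f x \<le> g x" "S \<in> sets lebesgue"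
  shows "i \<le> j"
proof -
  have "AE x in lebesgue_on S. g x = max (f x) (g x)" using assms(3) by eventually_elim simp
  then have "((\<lambda>x. max (f x) (g x)) has_integral j) S"
    using has_integral_cong_AE[where S = S and f = g and g = "\<lambda>x. max (f x) (g x)"] assms by blast
  with assms(1) show ?thesis by (rule has_integral_le) simp
qed

text \<open>A nonnegative continuous function with zero integral vanishes; applied to
  \<open>\<bar>f - g\<bar>\<close>.\<close>

lemma AE_eq_imp_eq_on_interval:
  fixes f g :: "real \<Rightarrow> real"
  assumes "continuous_on {0..l} f" "continuous_on {0..l} g" "AE s in lebesgue_on {0..l}. f s = g s"
    and "l > 0" "s \<in> {0..l}"
  shows "f s = g s"
proof -
  have "AE s in lebesgue_on {0..l}. \<bar>f s - g s\<bar> = 0" using assms(3) by eventually_elim simp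
  then have "((\<lambda>s. \<bar>f s - g s\<bar>) has_integral 0) {0..l}"
    using has_integral_cong_AE[where S = "{0..l}" and f = "\<lambda>s. \<bar>f s - g s\<bar>" and g = "\<lambda>_. 0" and y = 0] by simp
  then have "integral {0..l} (\<lambda>s. \<bar>f s - g s\<bar>) = 0" by (rule integral_unique)
  moreover have "continuous_on {0..l} (\<lambda>s. \<bar>f s - g s\<bar>)" using assms by (intro continuous_intros)
  ultimately have "\<forall>s\<in>{0..l}. \<bar>f s - g s\<bar> = 0" using integral_eq_0_iff[of 0 l] assms(4) by force
  then show ?thesis using assms(5) by simp
qed

lemma W2inf_rep_lip_prim: "W2inf_rep l \<gamma> T \<kappa> \<Longrightarrow> lip_prim l T \<kappa>"
  by (simp add: W2inf_rep_def lip_prim_def)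

lemma W1inf_rep_lip_prim: "W1inf_rep l g h \<Longrightarrow> lip_prim l g h"
  by (simp add: W1inf_rep_def lip_prim_def)

lemma W2inf_rep_deriv_unique:
  assumes "W2inf_rep l \<gamma> T \<kappa>" "W2inf_rep l \<gamma> T' \<kappa>'" "l > 0" "s \<in> {0..l}"
  shows "T s = T' s"
  using vector_derivative_unique_within_closed_interval[of 0 l s \<gamma> "T s" "T' s"] assms
  by (auto simp: W2inf_rep_def)

text \<open>The derivative on a closed interval is unique, so the constraints hold for whichever
  representative is at hand, in particular for the one extracted from the infimum in
  \<open>K_alpha\<close>.\<close>

lemma in_G_rep:
  assumes "in_G l a1 a2 T1 T2 \<gamma>" "W2inf_rep l \<gamma> T \<kappa>" "l > 0"
  shows "\<And>s. s \<in> {0..l} \<Longrightarrow> norm (T s) = 1" "T 0 = T1" "T l = T2" "\<gamma> 0 = a1" "\<gamma> l = a2"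
proof -
  obtain T' \<kappa>' where T': "W2inf_rep l \<gamma> T' \<kappa>'" "\<forall>s\<in>{0..l}. norm (T' s) = 1"
    "\<gamma> 0 = a1" "\<gamma> l = a2" "T' 0 = T1" "T' l = T2"
    using assms(1) unfolding in_G_def by blast
  have "T s = T' s" if "s \<in> {0..l}" for s
    using W2inf_rep_deriv_unique[OF assms(2) T'(1) assms(3) that] .
  then show "\<And>s. s \<in> {0..l} \<Longrightarrow> norm (T s) = 1" "T 0 = T1" "T l = T2" "\<gamma> 0 = a1" "\<gamma> l = a2"
    using T' assms(3) by auto
qed

text \<open>For \<open>W = 0\<close> the last coefficient is \<open>0 / 0 = 0\<close>, so the formula remains correct.\<close>

lemma proj_perp_orthogonal_pair:
  fixes V W x :: "'a::euclidean_space"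
  assumes V: "norm V = 1" and VW: "V \<bullet> W = 0"
  shows "proj_perp V W x = x - (x \<bullet> V) *\<^sub>R V - (x \<bullet> W / (W \<bullet> W)) *\<^sub>R W" (is "_ = ?p")
proof -
  have VV: "V \<bullet> V = 1" using V by (simp add: norm_eq_1)
  have WV: "W \<bullet> V = 0" using VW by (simp add: inner_commute)
  have p: "?p \<in> orthogonal_comp (span {V, W})"
  proof -
    have "orthogonal ?p y" if "y \<in> span {V, W}" for y
    proof (rule orthogonal_to_span[OF that])
      show "orthogonal ?p z" if "z \<in> {V, W}" for z
        using that VV VW WV by (auto simp: orthogonal_def inner_diff_left)
    qed
    then show ?thesis by (auto simp: orthogonal_comp_def orthogonal_commute)
  qed
  have s: "x - ?p \<in> span {V, W}"
    by (simp add: span_add span_scale span_base)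
  show ?thesis
    unfolding proj_perp_def
  proof (rule the_equality)
    show "?p \<in> orthogonal_comp (span {V, W}) \<and> x - ?p \<in> span {V, W}" using p s by blast
    fix q assume q: "q \<in> orthogonal_comp (span {V, W}) \<and> x - q \<in> span {V, W}"
    have d: "(x - ?p) - (x - q) \<in> span {V, W}" using s q span_diff by blast
    then have d': "q - ?p \<in> span {V, W}" by (simp add: algebra_simps)
    then have "orthogonal (q - ?p) q" "orthogonal (q - ?p) ?p"
      using p q by (auto simp: orthogonal_comp_def)
    then have "(q - ?p) \<bullet> (q - ?p) = 0" unfolding orthogonal_def by (simp only: inner_diff_right)
    then show "q = ?p" by simp
  qed
qed

text \<open>Taking the \<open>T\<close> component of \<open>f\<close> leaves only
  \<open>- g k\<^sup>2 / \<alpha>\<close>, whence \<open>\<alpha> |\<kappa>| = k\<close> where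
  \<open>g \<noteq> 0\<close>. The two \<open>\<kappa>\<close> terms of \<open>f\<close> then
  cancel.\<close>

lemma weak_equation_pointwise:
  fixes T \<kappa> lam f W :: "'a::euclidean_space" and \<alpha> g h k :: real
  assumes "\<alpha> > 0" "k > 0" and T: "norm T = 1" "T \<bullet> \<kappa> = 0" and W: "W = (g * \<alpha>) *\<^sub>R \<kappa>"
    and h: "h = \<alpha> * (lam \<bullet> \<kappa>)" "g = 0 \<longrightarrow> h = 0" and fT: "f \<bullet> T + W \<bullet> \<kappa> = 0"
    and f: "f = (h * \<alpha>) *\<^sub>R \<kappa> - (g * k\<^sup>2 / \<alpha>) *\<^sub>R T
       + k\<^sup>2 *\<^sub>R (lam - (lam \<bullet> T) *\<^sub>R T - (lam \<bullet> \<kappa> / (\<kappa> \<bullet> \<kappa>)) *\<^sub>R \<kappa>)"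
  shows "f = k\<^sup>2 *\<^sub>R (lam - (lam \<bullet> T + g / \<alpha>) *\<^sub>R T)" "g * \<alpha> * (\<kappa> \<bullet> \<kappa>) = g * k\<^sup>2 / \<alpha>" "norm W = \<bar>g\<bar> * k"
proof -
  have TT: "T \<bullet> T = 1" using T by (simp add: norm_eq_1)
  have "f \<bullet> T = - (g * k\<^sup>2 / \<alpha>)"
    unfolding f using T(2) TT by (simp add: inner_diff_left inner_add_left inner_commute[of \<kappa> T])
  then show eq: "g * \<alpha> * (\<kappa> \<bullet> \<kappa>) = g * k\<^sup>2 / \<alpha>" using fT unfolding W by simp
  have \<kappa>: "\<alpha>\<^sup>2 * (\<kappa> \<bullet> \<kappa>) = k\<^sup>2" if "g \<noteq> 0"
  proof -
    have "g * (\<alpha>\<^sup>2 * (\<kappa> \<bullet> \<kappa>)) = g * k\<^sup>2"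
      using eq assms(1) by (simp add: field_simps power2_eq_square)
    then show ?thesis using that by simp
  qed
  show "norm W = \<bar>g\<bar> * k"
  proof (cases "g = 0")
    case False
    have "(\<alpha> * norm \<kappa>)\<^sup>2 = k\<^sup>2" using \<kappa>[OF False] by (simp add: power_mult_distrib power2_norm_eq_inner)
    then have "\<alpha> * norm \<kappa> = k" using assms(1,2) by (simp add: power2_eq_iff_nonneg)
    then show ?thesis using assms(1) unfolding W by (simp add: abs_mult mult.assoc)
  qed (simp add: W)
  \<comment> \<open>Cancellation of the \<open>\<kappa>\<close> terms: for
    \<open>g \<noteq> 0\<close> by \<open>k\<^sup>2 = \<alpha>\<^sup>2 |\<kappa>|\<^sup>2\<close>;
    for \<open>g = 0\<close> because \<open>h = 0\<close> forces
    \<open>lam \<bullet> \<kappa> = 0\<close>.\<close>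
  have "h * \<alpha> = k\<^sup>2 * (lam \<bullet> \<kappa> / (\<kappa> \<bullet> \<kappa>))"
  proof (cases "g = 0")
    case True
    then show ?thesis using h assms(1) by simp
  next
    case False
    then have "\<kappa> \<bullet> \<kappa> \<noteq> 0" using \<kappa> assms(2) by auto
    then show ?thesis unfolding h(1) \<kappa>[OF False, symmetric] by (simp add: power2_eq_square)
  qed
  then show "f = k\<^sup>2 *\<^sub>R (lam - (lam \<bullet> T + g / \<alpha>) *\<^sub>R T)"
    unfolding f by (simp add: algebra_simps)
qed

text \<open>Ensures that \<open>real_of_ereal\<close> does not send an infinite value to 0, so that
  \<open>k\<close> is the true value of the functional.\<close>

lemma K_alpha_lt_infinity:
  assumes l: "l > 0" and \<alpha>: "bounded_variation_on l \<alpha>" "\<forall>s\<in>{0..l}. \<alpha> s > 0" and rep: "W2inf_rep l \<gamma> T \<kappa>"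
  shows "K_alpha \<alpha> l \<gamma> < \<infinity>"
proof -
  obtain A where A: "\<And>s. s \<in> {0..l} \<Longrightarrow> \<bar>\<alpha> s\<bar> \<le> A"
    using bounded_variation_bounded[OF \<alpha>(1)] l by (metis less_imp_le)
  obtain B where B: "B \<ge> 0" "\<And>s. s \<in> {0..l} \<Longrightarrow> norm (\<kappa> s) \<le> B"
    using lip_prim_bounded_deriv[OF W2inf_rep_lip_prim[OF rep]] by blast
  have "K_alpha \<alpha> l \<gamma> \<le> esssup (lebesgue_on {0..l}) (\<lambda>s. ereal (\<alpha> s * norm (\<kappa> s)))"
    unfolding K_alpha_def by (rule INF_lower) (use rep in blast)
  also have "\<dots> \<le> ereal (A * B)"
  proof (rule esssup_I)
    show "(\<lambda>s. ereal (\<alpha> s * norm (\<kappa> s))) \<in> borel_measurable (lebesgue_on {0..l})"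
    proof -
      note [measurable] = bounded_variation_measurable[OF \<alpha>(1)] lip_prim_measurable[OF W2inf_rep_lip_prim[OF rep]]
      show ?thesis by measurable
    qed
    have "\<alpha> s * norm (\<kappa> s) \<le> A * B" if "s \<in> {0..l}" for s
      using A[OF that] B that \<alpha>(2) by (intro mult_mono) force+
    then show "AE s in lebesgue_on {0..l}. ereal (\<alpha> s * norm (\<kappa> s)) \<le> ereal (A * B)"
      by (intro AE_I2) (auto simp: space_restrict_space)
  qed
  finally show ?thesis by (rule order.strict_trans1) simp
qed

text \<open>Strict inequality selects one representative of the second derivative and leaves a real
  gap between its bound \<open>k'\<close> and \<open>k\<close>. Nonnegativity of \<open>k'\<close>
  follows because the almost-everywhere bound holds at some point of an interval of positive
  length.\<close>

lemma K_alpha_lt_obtain: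
  assumes "K_alpha \<alpha> l \<eta> < ereal k" "l > 0" "\<forall>s\<in>{0..l}. \<alpha> s > 0"
  obtains \<tau> \<kappa> k' where "W2inf_rep l \<eta> \<tau> \<kappa>" "0 \<le> k'" "k' < k"
    "AE s in lebesgue_on {0..l}. \<alpha> s * norm (\<kappa> s) \<le> k'"
proof -
  obtain \<kappa> \<tau> where \<kappa>: "W2inf_rep l \<eta> \<tau> \<kappa>" "esssup (lebesgue_on {0..l}) (\<lambda>s. ereal (\<alpha> s * norm (\<kappa> s))) < ereal k"
    using assms(1) unfolding K_alpha_def INF_less_iff by blast
  then obtain r where r: "esssup (lebesgue_on {0..l}) (\<lambda>s. ereal (\<alpha> s * norm (\<kappa> s))) < ereal r" "ereal r < ereal k"
    using ereal_dense2 by blast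
  have AE: "AE s in lebesgue_on {0..l}. \<alpha> s * norm (\<kappa> s) \<le> r"
    using esssup_AE[of "\<lambda>s. ereal (\<alpha> s * norm (\<kappa> s))" "lebesgue_on {0..l}"]
  proof eventually_elim
    case (elim s)
    then have "ereal (\<alpha> s * norm (\<kappa> s)) < ereal r" using r(1) by (rule order.strict_trans1)
    then show ?case by simp
  qed
  obtain N where N: "negligible N" "\<forall>s\<in>{0..l} - N. \<alpha> s * norm (\<kappa> s) \<le> r"
    using AE by (auto simp: AE_lebesgue_on_iff)
  have "\<not> {0..l} \<subseteq> N"
    using negligible_subset[OF N(1), of "{0..l}"] negligible_interval(1)[of 0 l] assms(2) by auto
  then obtain s where "s \<in> {0..l}" "s \<notin> N" by blast
  then have "0 \<le> r" using N(2) assms(3) by (meson DiffI less_imp_le mult_nonneg_nonneg norm_ge_zero order_trans)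
  then show ?thesis using that[OF \<kappa>(1)] r(2) AE by simp
qed

theorem mainTheorem2:
  fixes l :: real and \<alpha> :: "real \<Rightarrow> real"
    and a1 a2 T1 T2 lam :: "'a::euclidean_space"
    and \<gamma> T \<kappa> :: "real \<Rightarrow> 'a" and g h :: "real \<Rightarrow> real" and k :: real
  assumes dim: "DIM('a) \<ge> 2"
    and l_pos: "l > 0"
    and alpha_pos: "\<forall>s\<in>{0..l}. \<alpha> s > 0"
    and alpha_bv: "bounded_variation_on l \<alpha>"
    and alpha_inv_bdd: "\<exists>C. \<forall>s\<in>{0..l}. 1 / \<alpha> s \<le> C"
    and T1: "norm T1 = 1" and T2: "norm T2 = 1"
    and G: "in_G l a1 a2 T1 T2 \<gamma>"
    and rep: "W2inf_rep l \<gamma> T \<kappa>"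
    and k_def: "k = real_of_ereal (K_alpha \<alpha> l \<gamma>)"
    and lam: "norm lam = 1"
    and g_W1: "W1inf_rep l g h"
    and g_nz: "\<exists>s\<in>{0..l}. g s \<noteq> 0"
    and eq1: "\<forall>\<xi>. test_vec l \<xi> \<longrightarrow>
       ((\<lambda>s. g s * \<alpha> s * (\<kappa> s \<bullet> vector_derivative \<xi> (at s))
             + h s * \<alpha> s * (\<kappa> s \<bullet> \<xi> s)
             - g s * k\<^sup>2 / \<alpha> s * (T s \<bullet> \<xi> s)
             + k\<^sup>2 * (proj_perp (T s) (\<kappa> s) lam \<bullet> \<xi> s)) has_integral 0) {0..l}"
    and eq2: "\<forall>\<phi>. test_fun l \<phi> \<longrightarrow>
       ((\<lambda>s. g s * deriv \<phi> s + \<alpha> s * (lam \<bullet> \<kappa> s) * \<phi> s) has_integral 0) {0..l}"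
    and g_bounds: "\<forall>s\<in>{0..l}. 0 \<le> g s \<and> g s \<le> - \<alpha> s * (lam \<bullet> T s)"
  shows "\<forall>\<eta>. in_G l a1 a2 T1 T2 \<eta> \<longrightarrow> K_alpha \<alpha> l \<gamma> \<le> K_alpha \<alpha> l \<eta>"
proof (intro allI impI)
  fix \<eta> :: "real \<Rightarrow> 'a" assume \<eta>: "in_G l a1 a2 T1 T2 \<eta>"
  show "K_alpha \<alpha> l \<gamma> \<le> K_alpha \<alpha> l \<eta>"
  proof (rule ccontr)
    assume "\<not> K_alpha \<alpha> l \<gamma> \<le> K_alpha \<alpha> l \<eta>"
    then have lt: "K_alpha \<alpha> l \<eta> < K_alpha \<alpha> l \<gamma>" by simp
    \<comment> \<open>The bounds on \<open>\<alpha>\<close> and \<open>\<kappa>\<close> exclude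
      infinity, and \<open>lt\<close> excludes minus infinity.\<close>
    have "K_alpha \<alpha> l \<gamma> = ereal k"
      using K_alpha_lt_infinity[OF l_pos alpha_bv alpha_pos rep] lt unfolding k_def
      by (cases "K_alpha \<alpha> l \<gamma>") auto
    then obtain \<tau> \<kappa>' k' where rep': "W2inf_rep l \<eta> \<tau> \<kappa>'" and k': "0 \<le> k'" "k' < k"
      and \<kappa>': "AE s in lebesgue_on {0..l}. \<alpha> s * norm (\<kappa>' s) \<le> k'"
      using K_alpha_lt_obtain[of \<alpha> l \<eta> k] lt l_pos alpha_pos by metis
    have k: "k > 0" using k' by simp
    note TG = in_G_rep[OF G rep l_pos]
    note \<tau>G = in_G_rep[OF \<eta> rep' l_pos]
    note T = W2inf_rep_lip_prim[OF rep]
    note \<tau> = W2inf_rep_lip_prim[OF rep']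
    note g = W1inf_rep_lip_prim[OF g_W1]
    obtain A where A: "A > 0" "\<And>s. s \<in> {0..l} \<Longrightarrow> \<alpha> s \<le> A"
    proof -
      obtain A where "\<And>s. s \<in> {0..l} \<Longrightarrow> \<bar>\<alpha> s\<bar> \<le> A"
        using bounded_variation_bounded[OF alpha_bv] l_pos by (metis less_imp_le)
      then show ?thesis using that[of "max 1 A"] by force
    qed
    have AE_space: "AE s in lebesgue_on {0..l}. s \<in> {0..l}"
      by (rule AE_I2) (simp add: space_restrict_space)

    have \<alpha>_bm: "bdd_measurable l \<alpha>"
      using bounded_variation_measurable[OF alpha_bv] A(2) alpha_pos unfolding bdd_measurable_def
      by (intro conjI exI[of _ A]) (auto simp: abs_of_pos)
    have inv_bm: "bdd_measurable l (\<lambda>s. 1 / \<alpha> s)"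
    proof -
      obtain C where "\<forall>s\<in>{0..l}. 1 / \<alpha> s \<le> C" using alpha_inv_bdd by blast
      then have "\<forall>s\<in>{0..l}. norm (1 / \<alpha> s) \<le> C" using alpha_pos by (simp add: abs_of_pos)
      moreover have "(\<lambda>s. 1 / \<alpha> s) \<in> borel_measurable (lebesgue_on {0..l})"
        using bounded_variation_measurable[OF alpha_bv] by (intro borel_measurable_divide) auto
      ultimately show ?thesis unfolding bdd_measurable_def by blast
    qed
    note bm = lip_prim_bdd_measurable[OF T] lip_prim_bdd_measurable[OF g] \<alpha>_bm inv_bm

    \<comment> \<open>\<open>P\<close> is the formula for the projection valid where
      \<open>T \<bullet> \<kappa> = 0\<close>; unlike \<open>proj_perp\<close> it is visibly
      measurable and bounded. \<open>f\<close> collects the terms of the weak equation that contain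
      \<open>\<xi>\<close> undifferentiated, so it is the weak derivative of
      \<open>g \<alpha> \<kappa>\<close>.\<close>
    define P where "P = (\<lambda>s. lam - (lam \<bullet> T s) *\<^sub>R T s - (lam \<bullet> \<kappa> s / (\<kappa> s \<bullet> \<kappa> s)) *\<^sub>R \<kappa> s)"
    define f where "f = (\<lambda>s. (h s * \<alpha> s) *\<^sub>R \<kappa> s - (g s * k\<^sup>2 / \<alpha> s) *\<^sub>R T s + k\<^sup>2 *\<^sub>R P s)"
    have P_bm: "bdd_measurable l P"
    proof -
      have "bdd_measurable l (\<lambda>s. (lam \<bullet> \<kappa> s / (\<kappa> s \<bullet> \<kappa> s)) *\<^sub>R \<kappa> s)"
      proof -
        have "norm ((lam \<bullet> \<kappa> s / (\<kappa> s \<bullet> \<kappa> s)) *\<^sub>R \<kappa> s) \<le> 1" for s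
        proof (cases "\<kappa> s = 0")
          case False
          have "\<bar>lam \<bullet> \<kappa> s\<bar> * norm (\<kappa> s) \<le> norm (\<kappa> s) * norm (\<kappa> s)"
            using Cauchy_Schwarz_ineq2[of lam "\<kappa> s"] lam by (intro mult_right_mono) auto
          then show ?thesis using False
            by (simp add: dot_square_norm power2_eq_square divide_le_eq)
        qed simp
        moreover have "(\<lambda>s. (lam \<bullet> \<kappa> s / (\<kappa> s \<bullet> \<kappa> s)) *\<^sub>R \<kappa> s) \<in> borel_measurable (lebesgue_on {0..l})"
          by (intro borel_measurable_scaleR borel_measurable_divide borel_measurable_inner
              borel_measurable_const lip_prim_measurable[OF T])
        ultimately show ?thesis unfolding bdd_measurable_def by blast
      qed
      moreover have "bdd_measurable l (\<lambda>s. lam \<bullet> T s)"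
        using bdd_measurable_inner_const[OF bm(1)] by (simp add: inner_commute)
      ultimately show ?thesis unfolding P_def
        by (intro bdd_measurable_diff[OF bdd_measurable_diff] bdd_measurable_const
            bdd_measurable_scaleR[of l "\<lambda>s. lam \<bullet> T s"] bm)
    qed
    have f_bm: "bdd_measurable l f"
    proof -
      have "bdd_measurable l (\<lambda>s. g s * k\<^sup>2 * (1 / \<alpha> s))"
        by (intro bdd_measurable_mult bdd_measurable_const bm)
      then have "bdd_measurable l (\<lambda>s. g s * k\<^sup>2 / \<alpha> s)" by simp
      then show ?thesis unfolding f_def
        by (intro bdd_measurable_add bdd_measurable_diff bdd_measurable_scaleR bdd_measurable_mult
            bdd_measurable_const bm P_bm)
    qed

    have T\<kappa>: "AE s in lebesgue_on {0..l}. T s \<bullet> \<kappa> s = 0"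
    proof -
      have "AE s in lebesgue_on {0..l}. \<kappa> s \<bullet> T s + T s \<bullet> \<kappa> s = 0"
      proof (rule AE_zero_if_indefinite_integral_zero[OF lip_prim_inner[OF T T]])
        fix s assume "s \<in> {0..l}"
        then show "T s \<bullet> T s = T 0 \<bullet> T 0" using TG(1)[of s] TG(1)[of 0] l_pos by (simp add: norm_eq_1)
      qed
      then show ?thesis by eventually_elim (simp add: inner_commute)
    qed

    \<comment> \<open>The second equation provides a primitive \<open>Q\<close> of
      \<open>\<alpha> (lam \<bullet> \<kappa>)\<close> agreeing with \<open>g\<close> almost
      everywhere, hence everywhere by continuity; two derivatives of one function agree almost
      everywhere.\<close>
    have h_eq: "AE s in lebesgue_on {0..l}. h s = \<alpha> s * (lam \<bullet> \<kappa> s)"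
    proof -
      have q: "bdd_measurable l (\<lambda>s. \<alpha> s * (lam \<bullet> \<kappa> s))"
        using bdd_measurable_mult[OF \<alpha>_bm bdd_measurable_inner_const[OF bm(2)], of lam] by (simp add: inner_commute)
      obtain Q where Q: "lip_prim l Q (\<lambda>s. \<alpha> s * (lam \<bullet> \<kappa> s))" "AE s in lebesgue_on {0..l}. g s = Q s"
        using du_bois_reymond[OF l_pos bm(3) q eq2[rule_format]] by blast
      have gQ: "g s = Q s" if "s \<in> {0..l}" for s
        using AE_eq_imp_eq_on_interval[OF lip_prim_continuous_on[OF g] lip_prim_continuous_on[OF Q(1)] Q(2) l_pos that] .
      have "lip_prim l Q h" using g gQ l_pos unfolding lip_prim_def by auto
      from AE_lip_prim_unique[OF this Q(1)] show ?thesis .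
    qed

    \<comment> \<open>Testing with \<open>\<phi> b\<close> for a scalar test function
      \<open>\<phi>\<close> reduces the vector equation to the scalar du Bois-Reymond lemma.\<close>
    have "\<exists>w. lip_prim l w (\<lambda>s. f s \<bullet> b) \<and> (AE s in lebesgue_on {0..l}. g s * \<alpha> s * (\<kappa> s \<bullet> b) = w s)"
      if b: "b \<in> Basis" for b
    proof -
      have p: "bdd_measurable l (\<lambda>s. g s * \<alpha> s * (\<kappa> s \<bullet> b))"
        by (intro bdd_measurable_mult bdd_measurable_inner_const bm)
      have q: "bdd_measurable l (\<lambda>s. f s \<bullet> b)" by (rule bdd_measurable_inner_const[OF f_bm])
      have weak: "((\<lambda>s. g s * \<alpha> s * (\<kappa> s \<bullet> b) * deriv \<phi> s + f s \<bullet> b * \<phi> s) has_integral 0) {0..l}"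
        if \<phi>: "test_fun l \<phi>" for \<phi>
      proof -
        have tv: "test_vec l (\<lambda>s. \<phi> s *\<^sub>R b)"
          unfolding test_vec_def
        proof
          fix b' :: 'a assume "b' \<in> Basis"
          then show "test_fun l (\<lambda>s. (\<phi> s *\<^sub>R b) \<bullet> b')"
            using \<phi> b test_fun_zero[OF l_pos] by (simp add: inner_Basis)
        qed
        have vd: "vector_derivative (\<lambda>s. \<phi> s *\<^sub>R b) (at s) = deriv \<phi> s *\<^sub>R b" for s
          by (rule vector_derivative_at)
             (use test_fun_differentiable[OF \<phi>] in \<open>auto intro!: derivative_eq_intros\<close>)
        from eq1[rule_format, OF tv] have "((\<lambda>s. g s * \<alpha> s * (\<kappa> s \<bullet> (deriv \<phi> s *\<^sub>R b)) + h s * \<alpha> s * (\<kappa> s \<bullet> (\<phi> s *\<^sub>R b))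
             - g s * k\<^sup>2 / \<alpha> s * (T s \<bullet> (\<phi> s *\<^sub>R b))
             + k\<^sup>2 * (proj_perp (T s) (\<kappa> s) lam \<bullet> (\<phi> s *\<^sub>R b))) has_integral 0) {0..l}"
          unfolding vd .
        moreover have "AE s in lebesgue_on {0..l}. g s * \<alpha> s * (\<kappa> s \<bullet> (deriv \<phi> s *\<^sub>R b)) + h s * \<alpha> s * (\<kappa> s \<bullet> (\<phi> s *\<^sub>R b))
             - g s * k\<^sup>2 / \<alpha> s * (T s \<bullet> (\<phi> s *\<^sub>R b))
             + k\<^sup>2 * (proj_perp (T s) (\<kappa> s) lam \<bullet> (\<phi> s *\<^sub>R b))
            = g s * \<alpha> s * (\<kappa> s \<bullet> b) * deriv \<phi> s + f s \<bullet> b * \<phi> s"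
          using T\<kappa> AE_space
        proof eventually_elim
          case (elim s)
          have "proj_perp (T s) (\<kappa> s) lam = P s"
            unfolding P_def by (rule proj_perp_orthogonal_pair[OF TG(1)[OF elim(2)] elim(1)])
          then show ?case
            unfolding f_def by (simp add: inner_add_left inner_diff_left algebra_simps)
        qed
        ultimately show ?thesis
          by (subst has_integral_cong_AE[symmetric]) auto
      qed
      show ?thesis
        by (rule du_bois_reymond[OF l_pos p q weak])
    qed
    then obtain w where w: "\<And>b. b \<in> Basis \<Longrightarrow> lip_prim l (w b) (\<lambda>s. f s \<bullet> b)"
      "\<And>b. b \<in> Basis \<Longrightarrow> AE s in lebesgue_on {0..l}. g s * \<alpha> s * (\<kappa> s \<bullet> b) = w b s"
      by metis
    define W where "W = (\<lambda>s. \<Sum>b\<in>Basis. w b s *\<^sub>R b)"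
    have Wb: "W s \<bullet> b = w b s" if "b \<in> Basis" for s b unfolding W_def by (rule inner_sum_left_Basis[OF that])
    have W: "lip_prim l W f"
      unfolding lip_prim_def
    proof (intro conjI ballI)
      show "(f has_integral W s - W 0) {0..s}" if s: "s \<in> {0..l}" for s
        unfolding has_integral_componentwise_iff[of f]
      proof
        fix b :: 'a assume b: "b \<in> Basis"
        show "((\<lambda>x. f x \<bullet> b) has_integral (W s - W 0) \<bullet> b) {0..s}"
          using w(1)[OF b] s unfolding lip_prim_def by (simp add: inner_diff_left Wb[OF b])
      qed
      show "\<exists>B. \<forall>s\<in>{0..l}. norm (f s) \<le> B" using f_bm unfolding bdd_measurable_def by blast
    qed
    have W_eq: "AE s in lebesgue_on {0..l}. W s = (g s * \<alpha> s) *\<^sub>R \<kappa> s"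
    proof -
      have "AE s in lebesgue_on {0..l}. \<forall>b\<in>Basis. g s * \<alpha> s * (\<kappa> s \<bullet> b) = w b s"
        using w(2) by (intro AE_finite_allI) auto
      then show ?thesis
        by eventually_elim (rule euclidean_eqI, simp add: Wb)
    qed
    have WT: "W s \<bullet> T s = 0" if "s \<in> {0..l}" for s
    proof (rule AE_eq_imp_eq_on_interval[where g = "\<lambda>_. 0", OF _ _ _ l_pos that])
      show "continuous_on {0..l} (\<lambda>s. W s \<bullet> T s)"
        by (intro continuous_on_inner lip_prim_continuous_on[OF W] lip_prim_continuous_on[OF T])
      show "AE s in lebesgue_on {0..l}. W s \<bullet> T s = 0"
        using W_eq T\<kappa> by eventually_elim (simp add: inner_commute)
    qed simp
    \<comment> \<open>The scalar relation that determines the curvature where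
      \<open>g > 0\<close>.\<close>
    have WT': "AE s in lebesgue_on {0..l}. f s \<bullet> T s + W s \<bullet> \<kappa> s = 0"
    proof (rule AE_zero_if_indefinite_integral_zero[OF lip_prim_inner[OF W T]])
      show "W s \<bullet> T s = W 0 \<bullet> T 0" if "s \<in> {0..l}" for s using WT[OF that] WT[of 0] l_pos by simp
    qed

    \<comment> \<open>Comes from the gap term \<open>k (k - k') g / \<alpha>\<close> with
      \<open>\<alpha> \<le> A\<close>; a constant factor leaves the integral of the continuous
      \<open>g\<close> alone to be estimated.\<close>
    let ?c = "k * (k - k') / A"
    have "AE s in lebesgue_on {0..l}. k\<^sup>2 * (lam \<bullet> (T s - \<tau> s)) + ?c * g s
        \<le> f s \<bullet> (T s - \<tau> s) + W s \<bullet> (\<kappa> s - \<kappa>' s)"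
      using T\<kappa> h_eq W_eq WT' AE_deriv_zero_on_zero_set[OF g] \<kappa>' AE_space
    proof eventually_elim
      case (elim s)
      have s: "s \<in> {0..l}" by (rule elim(7))
      have a: "\<alpha> s > 0" using alpha_pos s by blast
      have gs: "0 \<le> g s" "g s \<le> - \<alpha> s * (lam \<bullet> T s)" using g_bounds s by auto
      have fs: "f s = (h s * \<alpha> s) *\<^sub>R \<kappa> s - (g s * k\<^sup>2 / \<alpha> s) *\<^sub>R T s
          + k\<^sup>2 *\<^sub>R (lam - (lam \<bullet> T s) *\<^sub>R T s - (lam \<bullet> \<kappa> s / (\<kappa> s \<bullet> \<kappa> s)) *\<^sub>R \<kappa> s)"
        by (simp only: f_def P_def)
      note pw = weak_equation_pointwise[OF a k TG(1)[OF s] elim(1) elim(3) elim(2) elim(5) elim(4) fs]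
      have "0 \<le> - (lam \<bullet> T s + g s / \<alpha> s)"
        using gs(2) a by (simp add: field_simps)
      moreover have "0 \<le> T s \<bullet> (T s - \<tau> s)"
        using norm_cauchy_schwarz[of "T s" "\<tau> s"] TG(1)[OF s] \<tau>G(1)[OF s] by (simp add: inner_diff_right norm_eq_1)
      ultimately have "0 \<le> - (lam \<bullet> T s + g s / \<alpha> s) * (T s \<bullet> (T s - \<tau> s))"
        by (rule mult_nonneg_nonneg)
      then have "0 \<le> k\<^sup>2 * (- (lam \<bullet> T s + g s / \<alpha> s) * (T s \<bullet> (T s - \<tau> s)))"
        by (rule mult_nonneg_nonneg[OF zero_le_power2])
      moreover have "f s \<bullet> (T s - \<tau> s) = k\<^sup>2 * (lam \<bullet> (T s - \<tau> s))
          + k\<^sup>2 * (- (lam \<bullet> T s + g s / \<alpha> s) * (T s \<bullet> (T s - \<tau> s)))"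
      proof -
        have "(k\<^sup>2 *\<^sub>R (lam - m *\<^sub>R T s)) \<bullet> v = k\<^sup>2 * (lam \<bullet> v) + k\<^sup>2 * (- m * (T s \<bullet> v))" for m v
          by (simp add: inner_diff_left right_diff_distrib)
        then show ?thesis by (subst pw(1))
      qed
      ultimately have f_ge: "k\<^sup>2 * (lam \<bullet> (T s - \<tau> s)) \<le> f s \<bullet> (T s - \<tau> s)" by linarith
      have "W s \<bullet> \<kappa> s = g s * k\<^sup>2 / \<alpha> s" using pw(2) by (simp add: elim(3))
      \<comment> \<open>Cauchy-Schwarz with \<open>|W| = g k\<close> and the competitor's bound
        \<open>|\<kappa>'| \<le> k' / \<alpha>\<close>.\<close>
      moreover have "W s \<bullet> \<kappa>' s \<le> g s * k * (k' / \<alpha> s)"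
      proof -
        have "norm (\<kappa>' s) \<le> k' / \<alpha> s" using elim(6) a by (simp add: field_simps)
        then have "norm (W s) * norm (\<kappa>' s) \<le> g s * k * (k' / \<alpha> s)"
          unfolding pw(3) using gs(1) k by (intro mult_mono) auto
        then show ?thesis using norm_cauchy_schwarz[of "W s" "\<kappa>' s"] by linarith
      qed
      moreover have "?c * g s \<le> g s * k\<^sup>2 / \<alpha> s - g s * k * (k' / \<alpha> s)"
      proof -
        have "k * (k - k') * g s / A \<le> k * (k - k') * g s / \<alpha> s"
          using A(1) A(2)[OF s] a k k' gs(1) by (intro divide_left_mono mult_nonneg_nonneg) auto
        then show ?thesis using a by (simp add: field_simps power2_eq_square)
      qed
      ultimately show ?case using f_ge by (simp add: inner_diff_right)
    qed
    moreover have "((\<lambda>s. f s \<bullet> (T s - \<tau> s) + W s \<bullet> (\<kappa> s - \<kappa>' s)) has_integral 0) {0..l}"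
      using lip_prim_interval[OF lip_prim_inner[OF W lip_prim_diff[OF T \<tau>]], of 0 l] l_pos TG \<tau>G by simp
    \<comment> \<open>The \<open>lam\<close> term contributes nothing: the integrals of
      \<open>T\<close> and \<open>\<tau>\<close> are the displacements of the two curves, which
      share both end points.\<close>
    moreover have "((\<lambda>s. k\<^sup>2 * (lam \<bullet> (T s - \<tau> s)) + ?c * g s) has_integral ?c * integral {0..l} g) {0..l}"
    proof -
      have "(T has_integral \<gamma> l - \<gamma> 0) {0..l}" "(\<tau> has_integral \<eta> l - \<eta> 0) {0..l}"
        using rep rep' l_pos unfolding W2inf_rep_def by (auto intro: fundamental_theorem_of_calculus)
      from has_integral_diff[OF this] have "((\<lambda>s. T s - \<tau> s) has_integral 0) {0..l}"
        using TG \<tau>G by simp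
      from has_integral_linear[OF this bounded_linear_inner_right[of lam]]
      have "((\<lambda>s. lam \<bullet> (T s - \<tau> s)) has_integral 0) {0..l}" by (simp add: o_def)
      from has_integral_add[OF has_integral_mult_right[OF this, of "k\<^sup>2"]
          has_integral_mult_right[OF integrable_integral[OF integrable_continuous_interval[OF lip_prim_continuous_on[OF g]]], of ?c]]
      show ?thesis by simp
    qed
    ultimately have "?c * integral {0..l} g \<le> 0"
      by (intro has_integral_le_AE) auto
    moreover have "?c > 0" using k k' A(1) by simp
    ultimately have "integral {0..l} g \<le> 0" by (meson linorder_not_less mult_pos_pos)
    moreover have "integral {0..l} g \<ge> 0"
      by (rule integral_nonneg[OF integrable_continuous_interval[OF lip_prim_continuous_on[OF g]]]) (use g_bounds in blast)
    ultimately have "integral {0..l} g = 0" by simp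
    then have "\<forall>s\<in>{0..l}. g s = 0"
      using integral_eq_0_iff[OF lip_prim_continuous_on[OF g] l_pos] g_bounds by blast
    then show False using g_nz by blast
  qed
qed

end
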